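(* Let $\mathcal R$ be a Banach algebra. The Hahn holomorphic functions with values in $\mathcal R$ on $Y$ form a ring under usual (pointwise) addition and multiplication, and the map $\psi_{\mathcal R}:f\mapsto\mathfrak f$, sending a Hahn holomorphic function to its Hahn series, is a ring isomorphism onto its image in the ring of Hahn series $\mathcal R[[e_\Gamma]]$.
   Context: Logarithmic cover. $\mathcal Z$ is the logarithmic covering surface of $\mathbb C\setminus\{0\}$ with global polar coordinates $(r,\varphi)\in(0,\infty)\times\mathbb R$; for $z=(r,\varphi)$ write $|z|=r$, $\arg z=\varphi$. $\mathcal Z_0=\mathcal Z\cup\{0\}$ carries the topology generated by the open sets of $\mathcal Z$ and the discs $D_\epsilon=\{0\}\cup\{z\in\mathcal Z: |z|<\epsilon\}$. The positive real axis is identified with $\{z\in\mathcal Z:\arg z=0\}$. $Y\subset\mathcal Z$ is an open set containing an interval $(0,\delta)$ for some $\delta>0$, and $Y_0=Y\cup\{0\}$. Exponents. $(\Gamma,+)$ is a linearly ordered abelian group, $\Gamma^+=\{\gamma\in\Gamma:\gamma>0\}$, $\Gamma^+_0=\Gamma^+\cup\{0\}$. $\gamma\mapsto e_\gamma$ is a group homomorphism from $\Gamma$ to the multiplicative group of nowhere vanishing holomorphic functions on $Y$, such that for every $\gamma>0$ the function $e_\gamma$ is bounded on $Y$ and $\lim_{z\to0}|e_\gamma(z)|=0$. Put $\|e_\gamma\|_{Y,\epsilon}=\sup_{z\in Y\cap D_\epsilon}|e_\gamma(z)|$. Hahn series. A Hahn series with coefficients in $\mathcal R$ is a formal series $\mathfrak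 h=\sum_{\gamma\in\Gamma}a_\gamma e_\gamma$, $a_\gamma\in\mathcal R$, whose support $\{\gamma: a_\gamma\ne0\}$ is well-ordered; these form a ring $\mathcal R[[e_\Gamma]]$ under termwise addition and the product $(\sum a_\alpha e_\alpha)(\sum b_\beta e_\beta)=\sum c_\gamma e_\gamma$, $c_\gamma=\sum_{\alpha+\beta=\gamma}a_\alpha b_\beta$. For normed $\mathcal R$, $\mathfrak h$ is normally convergent in $Y\cap D_\epsilon$ if its support is countable and $\sum_\gamma\|a_\gamma\|\,\|e_\gamma\|_{Y,\epsilon}<\infty$. Admissibility. For $S\subset\Gamma_0^+$, a family $\{e_\alpha\}_{\alpha\in S}$ is weakly monotonous if there is $r_S>0$ such that for every $x\in(0,r_S)$ there is $\rho(x)$ with $0<\rho(x)\le x$ and $\|e_\alpha\|_{Y,\rho(x)}\le|e_\alpha(x)|$ for all $\alpha\in S$. A (well-ordered) set $S\subset\Gamma^+_0$ is admissible if $\{e_\alpha\}_{\alpha\in S}$ is weakly monotonous and for every nonempty $B\subset S$ the family $\{e_{\alpha-\min B}\}_{\alpha\in S,\ \alpha>\min B}$ is weakly monotonous. Hahn holomorphic. A continuous function $h:Y_0\to\mathcal R$, holomorphic in $Y$, is Hahn holomorphic (on $Y$) if there is a Hahn series $\mathfrak h=\sum_\gamma a_\gamma e_\gamma$ with countable admissible support (contained in $\Gamma_0^+$), converging normally on $Y\cap D_\delta$ for some $\delta>0$, with $h(z)=\sum_\gamma a_\gamma e_\gamma(z)$ for $z\in Y\cap D_\delta$. The series $\mathfrak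 h$ is uniquely determined by $h$ and is called the Hahn series of $h$.
   Formalization: The isomorphism onto the image is stated only when Y ∪ {0} is connected; otherwise a nonzero constant on a part of Y away from 0, extended by zero, is a nonzero Hahn holomorphic function with zero Hahn series, so injectivity fails. *)

theory Defs
  imports "HOL-Analysis.Analysis" "HOL-Algebra.QuotRing"
begin

section \<open>Complex Banach algebras\<close>

text \<open>A unit is not part of the structure, and if there is one its norm need not be 1.\<close>

class complex_banach_algebra = real_normed_algebra + banach +
  fixes scaleC :: "complex \<Rightarrow> 'a \<Rightarrow> 'a"  (infixr \<open>*\<^sub>C\<close> 75)
  assumes scaleC_add_right: "c *\<^sub>C (x + y) = c *\<^sub>C x + c *\<^sub>C y"
    and scaleC_add_left: "(c + d) *\<^sub>C x = c *\<^sub>C x + d *\<^sub>C x"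
    and scaleC_scaleC: "c *\<^sub>C d *\<^sub>C x = (c * d) *\<^sub>C x"
    and scaleC_of_real: "complex_of_real t *\<^sub>C x = t *\<^sub>R x"
    and norm_scaleC: "norm (c *\<^sub>C x) = cmod c * norm x"
    and mult_scaleC_left: "(c *\<^sub>C x) * y = c *\<^sub>C (x * y)"
    and mult_scaleC_right: "x * (c *\<^sub>C y) = c *\<^sub>C (x * y)"

instantiation complex :: complex_banach_algebra
begin

definition scaleC_complex :: "complex \<Rightarrow> complex \<Rightarrow> complex"
  where "scaleC_complex = (*)"

instance
  by standard
    (simp_all add: scaleC_complex_def algebra_simps norm_mult scaleR_conv_of_real)

end

definition is_alg_unit :: "'r::complex_banach_algebra \<Rightarrow> bool"
  where "is_alg_unit u \<longleftrightarrow> (\<forall>x. u * x = x \<and> x * u = x)"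

text \<open>Unspecified if the algebra has no unit.\<close>

definition alg_unit :: "'r::complex_banach_algebra"
  where "alg_unit = (THE u. is_alg_unit u)"


section \<open>The logarithmic cover\<close>

text \<open>A point of the cover is given by its polar coordinates \<open>(r, \<phi>)\<close> with \<open>r > 0\<close>.
  The added point \<open>0\<close> is encoded as the pair \<open>(0, 0)\<close>; note that the topology
  \<open>log_cover0_top\<close> below is not the subspace topology of the plane at this point.\<close>

type_synonym cover_point = "real \<times> real"

definition log_cover :: "cover_point set"
  where "log_cover = {z. fst z > 0}"

definition cover0 :: cover_point
  where "cover0 = (0, 0)"

definition disc0 :: "real \<Rightarrow> cover_point set"
  where "disc0 \<epsilon> = insert cover0 {z \<in> log_cover. fst z < \<epsilon>}"

definition log_cover0_top :: "cover_point topology"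
  where "log_cover0_top =
    topology_generated_by ({U. open U \<and> U \<subseteq> log_cover} \<union> {disc0 \<epsilon> | \<epsilon>. \<epsilon> > 0})"

text \<open>The inverse of the biholomorphic global chart \<open>log z = ln r + \<i>\<phi>\<close>.\<close>

definition cover_exp :: "complex \<Rightarrow> cover_point"
  where "cover_exp w = (exp (Re w), Im w)"

definition cover_holomorphic :: "cover_point set \<Rightarrow> (cover_point \<Rightarrow> 'r::complex_banach_algebra) \<Rightarrow> bool"
  where "cover_holomorphic Y f \<longleftrightarrow>
    (\<forall>w. cover_exp w \<in> Y \<longrightarrow>
      (\<exists>D. ((f \<circ> cover_exp) has_derivative (\<lambda>h. h *\<^sub>C D)) (at w)))"

lemma log_cover_eq_range_cover_exp: "log_cover = range cover_exp"
proof -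
  have "z \<in> range cover_exp" if "fst z > 0" for z
    using that by (intro range_eqI[of _ _ "Complex (ln (fst z)) (snd z)"]) (simp add: cover_exp_def)
  then show ?thesis
    by (auto simp: log_cover_def cover_exp_def)
qed

lemma cover_holomorphic_complex_iff:
  fixes f :: "cover_point \<Rightarrow> complex"
  assumes "open Y"
  shows "cover_holomorphic Y f \<longleftrightarrow> (f \<circ> cover_exp) holomorphic_on (cover_exp -` Y)"
proof -
  have "continuous_on UNIV cover_exp"
    unfolding cover_exp_def by (intro continuous_intros)
  then have "open (cover_exp -` Y)"
    using assms by (simp add: open_vimage)
  then show ?thesis
    by (auto simp: cover_holomorphic_def holomorphic_on_open has_field_derivative_def
        scaleC_complex_def mult.commute)
qed


section \<open>Exponents\<close>

locale exponent_system =
  fixes Y :: "cover_point set"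
    and e :: "'g::linordered_ab_group_add \<Rightarrow> cover_point \<Rightarrow> complex"
  assumes Y_subset: "Y \<subseteq> log_cover"
    and Y_open: "open Y"
    and Y_interval: "\<exists>\<delta>>0. \<forall>x. 0 < x \<and> x < \<delta> \<longrightarrow> (x, 0) \<in> Y"
    and e_holomorphic: "cover_holomorphic Y (e \<gamma>)"
    and e_nonzero: "z \<in> Y \<Longrightarrow> e \<gamma> z \<noteq> 0"
    and e_add: "z \<in> Y \<Longrightarrow> e (\<alpha> + \<beta>) z = e \<alpha> z * e \<beta> z"
    and e_bounded: "\<gamma> > 0 \<Longrightarrow> bounded (e \<gamma> ` Y)"
    and e_tendsto_0: "\<gamma> > 0 \<Longrightarrow> ((\<lambda>z. cmod (e \<gamma> z)) \<longlongrightarrow> 0) (atin_within log_cover0_top cover0 Y)"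

definition exp_norm :: "cover_point set \<Rightarrow> ('g \<Rightarrow> cover_point \<Rightarrow> complex) \<Rightarrow> real \<Rightarrow> 'g \<Rightarrow> real"
  where "exp_norm Y e \<epsilon> \<gamma> = (SUP z\<in>Y \<inter> disc0 \<epsilon>. cmod (e \<gamma> z))"

text \<open>The requirement \<open>(x, 0) \<in> Y\<close> only says that \<open>r\<close> is so small that the values \<open>e\<^sub>\<alpha>(x)\<close>
  for \<open>0 < x < r\<close> are defined.\<close>

definition weakly_monotonous ::
    "cover_point set \<Rightarrow> ('g \<Rightarrow> cover_point \<Rightarrow> complex) \<Rightarrow> 'g set \<Rightarrow> bool"
  where "weakly_monotonous Y e S \<longleftrightarrow>
    (\<exists>r>0. \<forall>x. 0 < x \<and> x < r \<longrightarrow> (x, 0) \<in> Y \<and>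
      (\<exists>\<rho>. 0 < \<rho> \<and> \<rho> \<le> x \<and> (\<forall>\<alpha>\<in>S. exp_norm Y e \<rho> \<alpha> \<le> cmod (e \<alpha> (x, 0)))))"

definition well_ordered :: "'g::linorder set \<Rightarrow> bool"
  where "well_ordered S \<longleftrightarrow> (\<forall>B. B \<subseteq> S \<and> B \<noteq> {} \<longrightarrow> (\<exists>m\<in>B. \<forall>b\<in>B. m \<le> b))"

definition admissible ::
    "cover_point set \<Rightarrow> ('g::linordered_ab_group_add \<Rightarrow> cover_point \<Rightarrow> complex) \<Rightarrow> 'g set \<Rightarrow> bool"
  where "admissible Y e S \<longleftrightarrow>
    S \<subseteq> {0..} \<and> well_ordered S \<and> weakly_monotonous Y e S \<and>
    (\<forall>B m. B \<subseteq> S \<and> m \<in> B \<and> (\<forall>b\<in>B. m \<le> b) \<longrightarrow>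
      weakly_monotonous Y e {\<alpha> - m | \<alpha>. \<alpha> \<in> S \<and> \<alpha> > m})"


section \<open>Hahn series\<close>

text \<open>A formal series is represented by its coefficient function.\<close>

definition supp :: "('g \<Rightarrow> 'r::zero) \<Rightarrow> 'g set"
  where "supp a = {\<gamma>. a \<gamma> \<noteq> 0}"

definition hahn_mult ::
    "('g::linordered_ab_group_add \<Rightarrow> 'r::complex_banach_algebra) \<Rightarrow> ('g \<Rightarrow> 'r) \<Rightarrow> 'g \<Rightarrow> 'r"
  where "hahn_mult a b \<gamma> =
    (\<Sum>(\<alpha>, \<beta>) \<in> {(\<alpha>, \<beta>). \<alpha> \<in> supp a \<and> \<beta> \<in> supp b \<and> \<alpha> + \<beta> = \<gamma>}. a \<alpha> * b \<beta>)"

definition hahn_series_ring :: "('g::linordered_ab_group_add \<Rightarrow> 'r::complex_banach_algebra) ring"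
  where "hahn_series_ring =
    \<lparr>carrier = {a. well_ordered (supp a)},
     mult = hahn_mult,
     one = (\<lambda>\<gamma>. if \<gamma> = 0 then alg_unit else 0),
     zero = (\<lambda>\<gamma>. 0),
     add = (\<lambda>a b \<gamma>. a \<gamma> + b \<gamma>)\<rparr>"

text \<open>The second condition says that the suprema in the sum are finite; it is needed because the
  supremum of an unbounded set of reals is unspecified.\<close>

definition normally_convergent ::
    "cover_point set \<Rightarrow> ('g \<Rightarrow> cover_point \<Rightarrow> complex) \<Rightarrow> real \<Rightarrow> ('g \<Rightarrow> 'r::complex_banach_algebra) \<Rightarrow> bool"
  where "normally_convergent Y e \<epsilon> a \<longleftrightarrow>
    countable (supp a) \<and>
    (\<forall>\<gamma>\<in>supp a. bounded (e \<gamma> ` (Y \<inter> disc0 \<epsilon>))) \<and>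
    (\<lambda>\<gamma>. norm (a \<gamma>) * exp_norm Y e \<epsilon> \<gamma>) summable_on supp a"


section \<open>Hahn holomorphic functions\<close>

definition is_hahn_series_of ::
    "cover_point set \<Rightarrow> ('g::linordered_ab_group_add \<Rightarrow> cover_point \<Rightarrow> complex) \<Rightarrow>
      ('g \<Rightarrow> 'r::complex_banach_algebra) \<Rightarrow> (cover_point \<Rightarrow> 'r) \<Rightarrow> bool"
  where "is_hahn_series_of Y e a h \<longleftrightarrow>
    countable (supp a) \<and> admissible Y e (supp a) \<and>
    (\<exists>\<delta>>0. normally_convergent Y e \<delta> a \<and>
      (\<forall>z \<in> Y \<inter> disc0 \<delta>. ((\<lambda>\<gamma>. e \<gamma> z *\<^sub>C a \<gamma>) has_sum h z) (supp a)))"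

definition hahn_holomorphic ::
    "cover_point set \<Rightarrow> ('g::linordered_ab_group_add \<Rightarrow> cover_point \<Rightarrow> complex) \<Rightarrow>
      (cover_point \<Rightarrow> 'r::complex_banach_algebra) \<Rightarrow> bool"
  where "hahn_holomorphic Y e h \<longleftrightarrow>
    continuous_map (subtopology log_cover0_top (insert cover0 Y)) euclidean h \<and>
    cover_holomorphic Y h \<and>
    (\<exists>a. is_hahn_series_of Y e a h)"

definition hahn_series_of ::
    "cover_point set \<Rightarrow> ('g::linordered_ab_group_add \<Rightarrow> cover_point \<Rightarrow> complex) \<Rightarrow>
      (cover_point \<Rightarrow> 'r::complex_banach_algebra) \<Rightarrow> 'g \<Rightarrow> 'r"
  where "hahn_series_of Y e h = (THE a. is_hahn_series_of Y e a h)"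

text \<open>Functions on \<open>Y\<^sub>0\<close> are represented by total functions that are \<open>undefined\<close> off \<open>Y\<^sub>0\<close>.\<close>

definition hahn_holomorphic_ring ::
    "cover_point set \<Rightarrow> ('g::linordered_ab_group_add \<Rightarrow> cover_point \<Rightarrow> complex) \<Rightarrow>
      (cover_point \<Rightarrow> 'r::complex_banach_algebra) ring"
  where "hahn_holomorphic_ring Y e =
    \<lparr>carrier = {h \<in> extensional (insert cover0 Y). hahn_holomorphic Y e h},
     mult = (\<lambda>f g. restrict (\<lambda>z. f z * g z) (insert cover0 Y)),
     one = restrict (\<lambda>z. alg_unit) (insert cover0 Y),
     zero = restrict (\<lambda>z. 0) (insert cover0 Y),
     add = (\<lambda>f g. restrict (\<lambda>z. f z + g z) (insert cover0 Y))\<rparr>"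


section \<open>Rings without unit\<close>

text \<open>The library's \<^locale>\<open>ring\<close>, \<^const>\<open>ring_hom\<close> and \<^const>\<open>ring_iso\<close> include the unit.
  The notions here ignore the \<open>one\<close> field of the record.\<close>

locale nonunital_ring = abelian_group R for R (structure) +
  assumes nu_m_closed: "\<lbrakk>x \<in> carrier R; y \<in> carrier R\<rbrakk> \<Longrightarrow> x \<otimes> y \<in> carrier R"
    and nu_m_assoc: "\<lbrakk>x \<in> carrier R; y \<in> carrier R; z \<in> carrier R\<rbrakk> \<Longrightarrow> (x \<otimes> y) \<otimes> z = x \<otimes> (y \<otimes> z)"
    and nu_l_distr: "\<lbrakk>x \<in> carrier R; y \<in> carrier R; z \<in> carrier R\<rbrakk> \<Longrightarrow> (x \<oplus> y) \<otimes> z = x \<otimes> z \<oplus> y \<otimes> z"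
    and nu_r_distr: "\<lbrakk>x \<in> carrier R; y \<in> carrier R; z \<in> carrier R\<rbrakk> \<Longrightarrow> z \<otimes> (x \<oplus> y) = z \<otimes> x \<oplus> z \<otimes> y"

definition nonunital_ring_hom :: "('a, 'm) ring_scheme \<Rightarrow> ('b, 'n) ring_scheme \<Rightarrow> ('a \<Rightarrow> 'b) set"
  where "nonunital_ring_hom R S = hom R S \<inter> hom (add_monoid R) (add_monoid S)"

definition nonunital_ring_iso :: "('a, 'm) ring_scheme \<Rightarrow> ('b, 'n) ring_scheme \<Rightarrow> ('a \<Rightarrow> 'b) set"
  where "nonunital_ring_iso R S =
    {h \<in> nonunital_ring_hom R S. bij_betw h (carrier R) (carrier S)}"

end

theory Submission
  imports Defs "HOL-Complex_Analysis.Conformal_Mappings"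
begin

text \<open>
  The Hahn series of \<open>h\<close> is unique: dividing a vanishing series by \<open>e\<^sub>m\<close>, with \<open>m\<close> the least exponent
  of its support, leaves the coefficient \<open>c\<^sub>m\<close> plus a series that tends to \<open>0\<close> at \<open>0\<close>, dominated
  convergence being supplied by weak monotonicity. Hence \<open>\<psi>\<close> is well defined, and it is a homomorphism
  because a product of absolutely convergent series can be summed along \<open>\<alpha> + \<beta> = \<gamma>\<close>. The point of
  substance is that sums of admissible sets are admissible. By Dickson's lemma the pairs \<open>(\<alpha>, \<beta>)\<close> with
  \<open>\<alpha> + \<beta> > m\<close> lie above finitely many minimal ones, so \<open>\<alpha> + \<beta> - m\<close> is the sum of two shifted
  exponents and one of finitely many positive exponents, and a single positive exponent is always
  weakly monotonous. Injectivity is the identity theorem for Banach-valued functions on the connected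
  set \<open>Y\<^sub>0\<close>, reduced to the scalar case by functionals that separate points.
\<close>

section \<open>Well-ordered sets\<close>

text \<open>Normal convergence controls the functions \<open>e \<alpha>\<close>, whereas uniqueness
  works with the quotients \<open>e (\<alpha> - m)\<close>, whose divisor \<open>e m\<close> may be
  arbitrarily small near 0. Weak monotonicity removes this obstacle: it compares a supremum over a
  small disc with the value at one point x, where dividing by \<open>e m\<close> costs only a
  constant. Each weakly monotonous family brings its own radius, so only finite unions of families
  stay under control; this is why the finiteness in Dickson's lemma matters. The pairs used are
  minimal above m and are not decompositions of m, because \<alpha> + \<beta> > m allows \<alpha> to
  drop while \<beta> rises: in general no single decomposition of m lies below all such
  pairs.\<close>

lemma well_ordered_subset: "well_ordered T \<Longrightarrow> S \<subseteq> T \<Longrightarrow> well_ordered S"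
  unfolding well_ordered_def by blast

lemma well_ordered_min:
  assumes "well_ordered S" "S \<noteq> {}"
  obtains m where "m \<in> S" "\<And>b. b \<in> S \<Longrightarrow> m \<le> b"
proof -
  have "\<exists>m\<in>S. \<forall>b\<in>S. m \<le> b"
    using assms(1)[unfolded well_ordered_def, rule_format, of S] assms(2) by simp
  then show thesis using that by blast
qed

lemma well_ordered_Un:
  fixes S T :: "'g::linorder set"
  assumes "well_ordered S" "well_ordered T"
  shows "well_ordered (S \<union> T)"
  unfolding well_ordered_def
proof (intro allI impI, elim conjE)
  fix B assume B: "B \<subseteq> S \<union> T" "B \<noteq> {}"
  consider "B \<inter> S = {}" | "B \<inter> T = {}" | "B \<inter> S \<noteq> {}" "B \<inter> T \<noteq> {}"
    by blast
  then show "\<exists>m\<in>B. \<forall>b\<in>B. m \<le> b"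
  proof cases
    case 1
    then have "B \<subseteq> T" using B(1) by blast
    then show ?thesis using B(2) assms(2) unfolding well_ordered_def by blast
  next
    case 2
    then have "B \<subseteq> S" using B(1) by blast
    then show ?thesis using B(2) assms(1) unfolding well_ordered_def by blast
  next
    case 3
    obtain s where s: "s \<in> B \<inter> S" "\<And>b. b \<in> B \<inter> S \<Longrightarrow> s \<le> b"
      using well_ordered_min[OF well_ordered_subset[OF assms(1)] 3(1)] by blast
    obtain t where t: "t \<in> B \<inter> T" "\<And>b. b \<in> B \<inter> T \<Longrightarrow> t \<le> b"
      using well_ordered_min[OF well_ordered_subset[OF assms(2)] 3(2)] by blast
    show ?thesis
    proof (intro bexI ballI)
      show "min s t \<in> B" using s t by (auto simp: min_def)
      show "min s t \<le> b" if "b \<in> B" for b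
        using that B(1) s(2)[of b] t(2)[of b] by (auto simp: min_le_iff_disj)
    qed
  qed
qed

section \<open>Finite antichains and Dickson's lemma\<close>

text \<open>Among the elements with finitely many predecessors there is a greatest one, d. The least
  element beyond d would again have finitely many predecessors, so d is the last element of
  A.\<close>

lemma finite_if_well_ordered_both_ways:
  fixes A :: "'g::linorder set"
  assumes "well_ordered A" and max: "\<And>B. B \<subseteq> A \<Longrightarrow> B \<noteq> {} \<Longrightarrow> \<exists>m\<in>B. \<forall>b\<in>B. b \<le> m"
  shows "finite A"
proof (cases "A = {}")
  case False
  define D where "D = {d\<in>A. finite {x\<in>A. x \<le> d}}"
  obtain m where m: "m \<in> A" "\<And>b. b \<in> A \<Longrightarrow> m \<le> b"
    using well_ordered_min[OF assms(1) False] by blast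
  have "{x\<in>A. x \<le> m} = {m}"
    using m by (auto intro: antisym)
  then have "D \<noteq> {}"
    using m(1) by (auto simp: D_def)
  moreover have "D \<subseteq> A" by (auto simp: D_def)
  ultimately obtain d where d: "d \<in> D" "\<And>b. b \<in> D \<Longrightarrow> b \<le> d"
    using max by meson
  have "{x\<in>A. d < x} = {}"
  proof (rule ccontr)
    assume "{x\<in>A. d < x} \<noteq> {}"
    then obtain c where c: "c \<in> {x\<in>A. d < x}" "\<And>b. b \<in> {x\<in>A. d < x} \<Longrightarrow> c \<le> b"
      using well_ordered_min[OF well_ordered_subset[OF assms(1), of "{x\<in>A. d < x}"]] by blast
    have "{x\<in>A. x \<le> c} \<subseteq> insert c {x\<in>A. x \<le> d}"
      using c(2) by force
    then have "c \<in> D"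
      using c(1) d(1) by (auto simp: D_def intro: finite_subset)
    then show False
      using c(1) d(2) by fastforce
  qed
  then have "A \<subseteq> {x\<in>A. x \<le> d}"
    by force
  then show ?thesis
    using d(1) finite_subset by (auto simp: D_def)
qed simp

text \<open>Of two pairs with equal first entries one lies below the other, so an antichain projects
  injectively to its first entries. Second entries decrease as first entries grow; hence every
  nonempty set of first entries has a greatest element, the partner of the least second
  entry.\<close>

lemma finite_antichain:
  fixes S :: "'g::linorder set" and T :: "'h::linorder set"
  assumes "well_ordered S" "well_ordered T" "M \<subseteq> S \<times> T"
    and anti: "\<And>a b c d. (a, b) \<in> M \<Longrightarrow> (c, d) \<in> M \<Longrightarrow> a \<le> c \<Longrightarrow> b \<le> d \<Longrightarrow> a = c \<and> b = d"
  shows "finite M"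
proof (rule finite_imageD)
  show "inj_on fst M"
  proof (rule inj_onI)
    fix p q assume "p \<in> M" "q \<in> M" "fst p = fst q"
    then show "p = q"
      using anti[of "fst p" "snd p" "fst q" "snd q"] anti[of "fst q" "snd q" "fst p" "snd p"]
        linear[of "snd p" "snd q"]
      by (metis order_refl prod.collapse)
  qed
  show "finite (fst ` M)"
  proof (rule finite_if_well_ordered_both_ways)
    show "well_ordered (fst ` M)"
      by (rule well_ordered_subset[OF assms(1)]) (use assms(3) in auto)
  next
    fix B assume B: "B \<subseteq> fst ` M" "B \<noteq> {}"
    let ?N = "snd ` {p\<in>M. fst p \<in> B}"
    have "?N \<noteq> {}" using B by blast
    moreover have "well_ordered ?N"
      by (rule well_ordered_subset[OF assms(2)]) (use assms(3) in auto)
    ultimately obtain n where n: "n \<in> ?N" "\<And>b. b \<in> ?N \<Longrightarrow> n \<le> b"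
      using well_ordered_min by blast
    then obtain m where m: "(m, n) \<in> M" "m \<in> B" by force
    have "b \<le> m" if b: "b \<in> B" for b
    proof (rule ccontr)
      assume "\<not> b \<le> m"
      moreover obtain d where d: "(b, d) \<in> M" using b B by force
      moreover have "n \<le> d" using d n(2) b by force
      ultimately show False using anti[OF m(1) d] by (metis linear)
    qed
    then show "\<exists>m\<in>B. \<forall>b\<in>B. b \<le> m" using m(2) by blast
  qed
qed

lemma finite_minimal_pairs:
  fixes S :: "'g::linorder set" and T :: "'h::linorder set"
  assumes "well_ordered S" "well_ordered T" "P \<subseteq> S \<times> T"
  obtains M where "finite M" "M \<subseteq> P" "\<And>a b. (a, b) \<in> P \<Longrightarrow> \<exists>c d. (c, d) \<in> M \<and> c \<le> a \<and> d \<le> b"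
proof
  let ?M = "{(a, b) \<in> P. \<forall>c d. (c, d) \<in> P \<and> c \<le> a \<and> d \<le> b \<longrightarrow> c = a \<and> d = b}"
  show "finite ?M"
    using assms by (intro finite_antichain[of S T]) auto
  show "?M \<subseteq> P" by auto
  fix a b assume ab: "(a, b) \<in> P"
  \<comment> \<open>Minimise the first entry, then the second. Imposing only d \<le> b suffices for
    c \<le> a, because a itself is a candidate; and any pair below the resulting one is again a
    candidate, which gives minimality.\<close>
  let ?A = "{c. \<exists>d\<le>b. (c, d) \<in> P}"
  obtain c where c: "c \<in> ?A" "\<And>x. x \<in> ?A \<Longrightarrow> c \<le> x"
    using well_ordered_min[OF well_ordered_subset[OF assms(1), of ?A]] ab assms(3) by blast
  let ?B = "{d. d \<le> b \<and> (c, d) \<in> P}"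
  obtain d where d: "d \<in> ?B" "\<And>x. x \<in> ?B \<Longrightarrow> d \<le> x"
    using well_ordered_min[OF well_ordered_subset[OF assms(2), of ?B]] c(1) assms(3) by blast
  have "(c, d) \<in> ?M"
  proof (clarsimp, intro conjI allI impI)
    show "(c, d) \<in> P" using d by auto
    fix c' d' assume *: "(c', d') \<in> P \<and> c' \<le> c \<and> d' \<le> d"
    then have "c' \<in> ?A" using d(1) by (auto intro: order_trans)
    then show "c' = c" using c(2) * by (auto intro: antisym)
    then have "d' \<in> ?B" using d(1) * by (auto intro: order_trans)
    then show "d' = d" using d(2) * by (auto intro: antisym)
  qed
  moreover have "c \<le> a" "d \<le> b" using c d ab by auto
  ultimately show "\<exists>c d. (c, d) \<in> ?M \<and> c \<le> a \<and> d \<le> b" by blast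
qed

section \<open>Sums of well-ordered sets\<close>

definition sumset :: "'g::plus set \<Rightarrow> 'g set \<Rightarrow> 'g set"
  where "sumset S T = {\<alpha> + \<beta> | \<alpha> \<beta>. \<alpha> \<in> S \<and> \<beta> \<in> T}"

lemma sumset_nonneg:
  fixes S T :: "'g::linordered_ab_group_add set"
  assumes "S \<subseteq> {0..}" "T \<subseteq> {0..}"
  shows "sumset S T \<subseteq> {0..}"
proof
  fix \<gamma> assume "\<gamma> \<in> sumset S T"
  then obtain \<alpha> \<beta> where "\<gamma> = \<alpha> + \<beta>" "\<alpha> \<in> S" "\<beta> \<in> T"
    unfolding sumset_def by blast
  then show "\<gamma> \<in> {0..}"
    using assms by (metis add_nonneg_nonneg atLeast_iff subsetD)
qed

text \<open>Addition is strictly monotone in each argument, so its fibres are antichains. The sum in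
  \<open>hahn_mult\<close> is therefore a genuine finite sum; over an infinite index set it would be
  0 by default.\<close>

lemma finite_sum_fibre:
  fixes S T :: "'g::linordered_ab_group_add set"
  assumes "well_ordered S" "well_ordered T"
  shows "finite {(\<alpha>, \<beta>). \<alpha> \<in> S \<and> \<beta> \<in> T \<and> \<alpha> + \<beta> = \<gamma>}"
proof (rule finite_antichain[OF assms])
  fix a b c d
  assume *: "(a, b) \<in> {(\<alpha>, \<beta>). \<alpha> \<in> S \<and> \<beta> \<in> T \<and> \<alpha> + \<beta> = \<gamma>}"
    "(c, d) \<in> {(\<alpha>, \<beta>). \<alpha> \<in> S \<and> \<beta> \<in> T \<and> \<alpha> + \<beta> = \<gamma>}" "a \<le> c" "b \<le> d"
  have "a + b = c + d" using * by auto
  with *(3,4) show "a = c \<and> b = d"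
    by (metis add_le_less_mono add_less_le_mono less_le order.irrefl)
qed auto

text \<open>Every element of B dominates the sum of one of finitely many minimal pairs, and the
  least of these sums is the minimum of B.\<close>

lemma well_ordered_sumset:
  fixes S T :: "'g::linordered_ab_group_add set"
  assumes "well_ordered S" "well_ordered T"
  shows "well_ordered (sumset S T)"
  unfolding well_ordered_def
proof (intro allI impI, elim conjE)
  fix B assume B: "B \<subseteq> sumset S T" "B \<noteq> {}"
  let ?P = "{(\<alpha>, \<beta>). \<alpha> \<in> S \<and> \<beta> \<in> T \<and> \<alpha> + \<beta> \<in> B}"
  obtain M where M: "finite M" "M \<subseteq> ?P"
    "\<And>a b. (a, b) \<in> ?P \<Longrightarrow> \<exists>c d. (c, d) \<in> M \<and> c \<le> a \<and> d \<le> b"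
    by (rule finite_minimal_pairs[OF assms, of ?P]) auto
  let ?N = "(\<lambda>(a, b). a + b) ` M"
  have below: "\<exists>n\<in>?N. n \<le> x" if x: "x \<in> B" for x
  proof -
    obtain a b where ab: "x = a + b" "(a, b) \<in> ?P"
      using x B(1) unfolding sumset_def by blast
    obtain c d where "(c, d) \<in> M" "c \<le> a" "d \<le> b" using M(3)[OF ab(2)] by blast
    then show ?thesis using ab(1) by (intro bexI[of _ "c + d"]) (auto intro: add_mono)
  qed
  have N: "finite ?N" "?N \<noteq> {}" using M(1) below B(2) by blast+
  have "?N \<subseteq> B" using M(2) by auto
  then have "Min ?N \<in> B" using Min_in[OF N] by blast
  moreover have "Min ?N \<le> x" if "x \<in> B" for x
    using below[OF that] N(1) by (meson Min_le order_trans)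
  ultimately show "\<exists>m\<in>B. \<forall>b\<in>B. m \<le> b" by blast
qed

section \<open>Neighbourhoods of the point 0\<close>

text \<open>Among the generating sets only the discs contain \<open>cover0\<close>, and they are
  nested, so finite intersections and unions of generators keep a disc inside.\<close>

lemma openin_log_cover0_top_disc0:
  assumes "openin log_cover0_top U" "cover0 \<in> U"
  shows "\<exists>\<epsilon>>0. disc0 \<epsilon> \<subseteq> U"
proof -
  have "generate_topology_on ({U. open U \<and> U \<subseteq> log_cover} \<union> {disc0 \<epsilon> | \<epsilon>. \<epsilon> > 0}) U"
    using assms(1) by (simp add: log_cover0_top_def openin_topology_generated_by_iff)
  then show ?thesis
    using assms(2)
  proof induction
    case (Int a b)
    then obtain \<epsilon> \<epsilon>' where "\<epsilon> > 0" "\<epsilon>' > 0" "disc0 \<epsilon> \<subseteq> a" "disc0 \<epsilon>' \<subseteq> b" by auto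
    then show ?case
      by (intro exI[of _ "min \<epsilon> \<epsilon>'"]) (auto simp: disc0_def)
  next
    case (UN K)
    then show ?case by (meson Union_iff Union_upper order_trans)
  qed (auto simp: cover0_def log_cover_def)
qed

lemma openin_log_cover0_top_open: "open U \<Longrightarrow> U \<subseteq> log_cover \<Longrightarrow> openin log_cover0_top U"
  unfolding log_cover0_top_def by (intro topology_generated_by_Basis) auto

lemma openin_log_cover0_top_disc: "\<epsilon> > 0 \<Longrightarrow> openin log_cover0_top (disc0 \<epsilon>)"
  unfolding log_cover0_top_def by (intro topology_generated_by_Basis) auto

lemma open_log_cover: "open log_cover"
  unfolding log_cover_def by (intro open_Collect_less continuous_intros)

lemma topspace_log_cover0_top: "topspace log_cover0_top = insert cover0 log_cover"
proof
  show "topspace log_cover0_top \<subseteq> insert cover0 log_cover"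
    unfolding log_cover0_top_def topology_generated_by_topspace by (auto simp: disc0_def)
  have "disc0 1 \<subseteq> topspace log_cover0_top" "log_cover \<subseteq> topspace log_cover0_top"
    by (auto intro!: openin_subset openin_log_cover0_top_disc openin_log_cover0_top_open open_log_cover)
  then show "insert cover0 log_cover \<subseteq> topspace log_cover0_top"
    by (auto simp: disc0_def)
qed

lemma disc0_mono: "\<epsilon> \<le> \<epsilon>' \<Longrightarrow> disc0 \<epsilon> \<subseteq> disc0 \<epsilon>'"
  by (auto simp: disc0_def)

lemma cover0_notin_log_cover: "cover0 \<notin> log_cover"
  by (simp add: cover0_def log_cover_def)

section \<open>Weak monotonicity\<close>

context exponent_system
begin

lemma e_0: "z \<in> Y \<Longrightarrow> e 0 z = 1"
  using e_add[of z 0 0] e_nonzero[of z 0] by simp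

lemma cover0_notin_Y: "cover0 \<notin> Y"
  using Y_subset cover0_notin_log_cover by blast

lemma pos_axis_mem_disc0:
  assumes "0 < x" "x < \<rho>" "(x, 0) \<in> Y"
  shows "(x, 0) \<in> Y \<inter> disc0 \<rho>"
  using assms by (auto simp: disc0_def log_cover_def)

lemma Y_disc0_nonempty:
  assumes "0 < \<rho>"
  obtains x where "0 < x" "x < \<rho>" "(x, 0) \<in> Y" "(x, 0) \<in> Y \<inter> disc0 \<rho>"
proof -
  obtain \<delta> where \<delta>: "\<delta> > 0" "\<And>x. 0 < x \<Longrightarrow> x < \<delta> \<Longrightarrow> (x, 0) \<in> Y"
    using Y_interval by blast
  show thesis
    using \<delta> assms pos_axis_mem_disc0[of "min \<delta> \<rho> / 2" \<rho>] by (intro that[of "min \<delta> \<rho> / 2"]) auto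
qed

text \<open>A real supremum says something only for a bounded set, so this is what gives
  \<open>exp_norm\<close> its meaning at nonnegative exponents. The exponent 0 is treated apart
  because \<open>e_bounded\<close> speaks of positive ones.\<close>

lemma e_bdd_above:
  assumes "\<gamma> \<ge> 0" "A \<subseteq> Y"
  shows "bdd_above ((\<lambda>z. cmod (e \<gamma> z)) ` A)"
proof (cases "\<gamma> = 0")
  case True
  then show ?thesis using assms(2) by (intro bdd_aboveI[of _ 1]) (auto simp: e_0)
next
  case False
  then have "bounded (e \<gamma> ` Y)" using e_bounded assms by auto
  then show ?thesis using assms(2) by (force simp: bounded_iff bdd_above_def)
qed

lemma exp_norm_upper:
  assumes "\<gamma> \<ge> 0" "z \<in> Y \<inter> disc0 \<rho>"
  shows "cmod (e \<gamma> z) \<le> exp_norm Y e \<rho> \<gamma>"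
  unfolding exp_norm_def by (rule cSUP_upper[OF assms(2) e_bdd_above[OF assms(1)]]) auto

lemma exp_norm_least:
  assumes "\<rho> > 0" "\<And>z. z \<in> Y \<inter> disc0 \<rho> \<Longrightarrow> cmod (e \<gamma> z) \<le> B"
  shows "exp_norm Y e \<rho> \<gamma> \<le> B"
  unfolding exp_norm_def
  by (rule cSUP_least) (use assms Y_disc0_nonempty[OF assms(1)] in auto)

lemma exp_norm_nonneg:
  assumes "\<rho> > 0" "\<gamma> \<ge> 0"
  shows "exp_norm Y e \<rho> \<gamma> \<ge> 0"
  by (meson Y_disc0_nonempty[OF assms(1)] exp_norm_upper[OF assms(2)] norm_ge_zero order_trans)

lemma exp_norm_mono:
  assumes "0 < \<rho>" "\<rho> \<le> \<rho>'" "\<gamma> \<ge> 0"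
  shows "exp_norm Y e \<rho> \<gamma> \<le> exp_norm Y e \<rho>' \<gamma>"
  using assms disc0_mono[of \<rho> \<rho>'] by (intro exp_norm_least exp_norm_upper) auto

lemma exp_norm_add:
  assumes "0 < \<rho>" "\<alpha> \<ge> 0" "\<beta> \<ge> 0"
  shows "exp_norm Y e \<rho> (\<alpha> + \<beta>) \<le> exp_norm Y e \<rho> \<alpha> * exp_norm Y e \<rho> \<beta>"
proof (rule exp_norm_least[OF assms(1)])
  fix z assume z: "z \<in> Y \<inter> disc0 \<rho>"
  then have "cmod (e (\<alpha> + \<beta>) z) = cmod (e \<alpha> z) * cmod (e \<beta> z)"
    by (simp add: e_add norm_mult)
  also have "\<dots> \<le> exp_norm Y e \<rho> \<alpha> * exp_norm Y e \<rho> \<beta>"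
    using z assms by (intro mult_mono exp_norm_upper exp_norm_nonneg) auto
  finally show "cmod (e (\<alpha> + \<beta>) z) \<le> exp_norm Y e \<rho> \<alpha> * exp_norm Y e \<rho> \<beta>" .
qed

lemma eventually_near_0:
  assumes "eventually P (atin_within log_cover0_top cover0 Y)"
  obtains \<rho> where "\<rho> > 0" "\<And>z. z \<in> Y \<inter> disc0 \<rho> \<Longrightarrow> P z"
proof -
  obtain U where U: "openin log_cover0_top U" "cover0 \<in> U"
    "\<And>z. z \<in> U \<Longrightarrow> z \<in> Y \<Longrightarrow> z \<noteq> cover0 \<Longrightarrow> P z"
    using assms by (auto simp: eventually_atin_within topspace_log_cover0_top)
  obtain \<rho> where "\<rho> > 0" "disc0 \<rho> \<subseteq> U"
    using openin_log_cover0_top_disc0[OF U(1,2)] by blast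
  then show thesis
    using U(3) cover0_notin_Y that by blast
qed

lemma e_small_near_0:
  assumes "\<gamma> > 0" "c > 0"
  obtains \<rho> where "\<rho> > 0" "\<And>z. z \<in> Y \<inter> disc0 \<rho> \<Longrightarrow> cmod (e \<gamma> z) < c"
  using eventually_near_0[OF order_tendstoD(2)[OF e_tendsto_0[OF assms(1)] assms(2)]] by blast

abbreviation "wm \<equiv> weakly_monotonous Y e"

lemma wm_subset: "wm T \<Longrightarrow> S \<subseteq> T \<Longrightarrow> wm S"
  unfolding weakly_monotonous_def by (meson subsetD)

text \<open>Passing to the smaller of two radii preserves both families of estimates, by
  \<open>exp_norm_mono\<close>. Closure properties of weak monotonicity thereby reduce to an
  inequality at one fixed point x and one fixed radius \<rho>.\<close>

lemma wm_combine:
  assumes "wm S" "wm T" "S \<subseteq> {0..}" "T \<subseteq> {0..}"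
    and step: "\<And>\<gamma> x \<rho>. \<gamma> \<in> U \<Longrightarrow> (x, 0) \<in> Y \<Longrightarrow> \<rho> > 0 \<Longrightarrow>
      (\<And>\<alpha>. \<alpha> \<in> S \<Longrightarrow> exp_norm Y e \<rho> \<alpha> \<le> cmod (e \<alpha> (x, 0))) \<Longrightarrow>
      (\<And>\<beta>. \<beta> \<in> T \<Longrightarrow> exp_norm Y e \<rho> \<beta> \<le> cmod (e \<beta> (x, 0))) \<Longrightarrow>
      exp_norm Y e \<rho> \<gamma> \<le> cmod (e \<gamma> (x, 0))"
  shows "wm U"
proof -
  obtain r where r: "r > 0" "\<And>x. 0 < x \<Longrightarrow> x < r \<Longrightarrow> (x, 0) \<in> Y \<and>
      (\<exists>\<rho>. 0 < \<rho> \<and> \<rho> \<le> x \<and> (\<forall>\<alpha>\<in>S. exp_norm Y e \<rho> \<alpha> \<le> cmod (e \<alpha> (x, 0))))"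
    using assms(1) unfolding weakly_monotonous_def by blast
  obtain r' where r': "r' > 0" "\<And>x. 0 < x \<Longrightarrow> x < r' \<Longrightarrow> (x, 0) \<in> Y \<and>
      (\<exists>\<rho>. 0 < \<rho> \<and> \<rho> \<le> x \<and> (\<forall>\<alpha>\<in>T. exp_norm Y e \<rho> \<alpha> \<le> cmod (e \<alpha> (x, 0))))"
    using assms(2) unfolding weakly_monotonous_def by blast
  show ?thesis
    unfolding weakly_monotonous_def
  proof (rule exI[of _ "min r r'"], intro conjI allI impI)
    show "min r r' > 0" using r r' by auto
    fix x assume x: "0 < x \<and> x < min r r'"
    show xY: "(x, 0) \<in> Y" using r(2) x by auto
    obtain \<rho> where \<rho>: "0 < \<rho>" "\<rho> \<le> x" "\<And>\<alpha>. \<alpha>\<in>S \<Longrightarrow> exp_norm Y e \<rho> \<alpha> \<le> cmod (e \<alpha> (x, 0))"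
      using r(2)[of x] x by auto
    obtain \<rho>' where \<rho>': "0 < \<rho>'" "\<rho>' \<le> x" "\<And>\<alpha>. \<alpha>\<in>T \<Longrightarrow> exp_norm Y e \<rho>' \<alpha> \<le> cmod (e \<alpha> (x, 0))"
      using r'(2)[of x] x by auto
    let ?\<rho> = "min \<rho> \<rho>'"
    have pos: "?\<rho> > 0" using \<rho> \<rho>' by simp
    have "exp_norm Y e ?\<rho> \<alpha> \<le> cmod (e \<alpha> (x, 0))" if "\<alpha> \<in> S" for \<alpha>
      using \<rho>(3)[OF that] exp_norm_mono[OF pos, of \<rho> \<alpha>] that assms(3) by force
    moreover have "exp_norm Y e ?\<rho> \<alpha> \<le> cmod (e \<alpha> (x, 0))" if "\<alpha> \<in> T" for \<alpha>
      using \<rho>'(3)[OF that] exp_norm_mono[OF pos, of \<rho>' \<alpha>] that assms(4) by force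
    ultimately show "\<exists>\<rho>>0. \<rho> \<le> x \<and> (\<forall>\<alpha>\<in>U. exp_norm Y e \<rho> \<alpha> \<le> cmod (e \<alpha> (x, 0)))"
      using pos step[OF _ xY pos] \<rho>(2) by (intro exI[of _ ?\<rho>]) auto
  qed
qed

lemma wm_Un: "wm S \<Longrightarrow> wm T \<Longrightarrow> S \<subseteq> {0..} \<Longrightarrow> T \<subseteq> {0..} \<Longrightarrow> wm (S \<union> T)"
  by (rule wm_combine) blast+

text \<open>Suprema are submultiplicative while values at the point x are exactly multiplicative, so
  the two estimates can be multiplied.\<close>

lemma wm_sumset:
  assumes "wm S" "wm T" "S \<subseteq> {0..}" "T \<subseteq> {0..}"
  shows "wm (sumset S T)"
proof (rule wm_combine[OF assms])
  fix \<gamma> x \<rho>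
  assume "\<gamma> \<in> sumset S T" and x: "(x, 0) \<in> Y" "\<rho> > 0"
    and S: "\<And>\<alpha>. \<alpha> \<in> S \<Longrightarrow> exp_norm Y e \<rho> \<alpha> \<le> cmod (e \<alpha> (x, 0))"
    and T: "\<And>\<beta>. \<beta> \<in> T \<Longrightarrow> exp_norm Y e \<rho> \<beta> \<le> cmod (e \<beta> (x, 0))"
  then obtain \<alpha> \<beta> where ab: "\<gamma> = \<alpha> + \<beta>" "\<alpha> \<in> S" "\<beta> \<in> T"
    unfolding sumset_def by blast
  then have nn: "\<alpha> \<ge> 0" "\<beta> \<ge> 0" using assms(3,4) by auto
  have "exp_norm Y e \<rho> \<gamma> \<le> exp_norm Y e \<rho> \<alpha> * exp_norm Y e \<rho> \<beta>"
    using exp_norm_add[OF x(2) nn] ab(1) by simp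
  also have "\<dots> \<le> cmod (e \<alpha> (x, 0)) * cmod (e \<beta> (x, 0))"
    using ab nn x by (intro mult_mono S T exp_norm_nonneg) auto
  also have "\<dots> = cmod (e \<gamma> (x, 0))"
    using x ab(1) by (simp add: e_add norm_mult)
  finally show "exp_norm Y e \<rho> \<gamma> \<le> cmod (e \<gamma> (x, 0))" .
qed

lemma wm_empty: "wm {}"
proof -
  obtain \<delta> where "\<delta> > 0" "\<forall>x. 0 < x \<and> x < \<delta> \<longrightarrow> (x, 0) \<in> Y"
    using Y_interval by blast
  then show ?thesis
    unfolding weakly_monotonous_def by (intro exI[of _ \<delta>]) auto
qed

text \<open>A single exponent needs no hypothesis, since \<open>e\<^sub>\<gamma>\<close> has no zeros but tends to \<open>0\<close>.\<close>

lemma wm_singleton: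
  assumes "\<gamma> \<ge> 0"
  shows "wm {\<gamma>}"
proof -
  obtain \<delta> where \<delta>: "\<delta> > 0" "\<forall>x. 0 < x \<and> x < \<delta> \<longrightarrow> (x, 0) \<in> Y"
    using Y_interval by blast
  show ?thesis
    unfolding weakly_monotonous_def
  proof (rule exI[of _ \<delta>], intro conjI allI impI \<delta>(1))
    fix x assume x: "0 < x \<and> x < \<delta>"
    show xY: "(x, 0) \<in> Y" using \<delta> x by auto
    show "\<exists>\<rho>>0. \<rho> \<le> x \<and> (\<forall>\<alpha>\<in>{\<gamma>}. exp_norm Y e \<rho> \<alpha> \<le> cmod (e \<alpha> (x, 0)))"
    proof (cases "\<gamma> = 0")
      case True
      then have "exp_norm Y e x \<gamma> \<le> cmod (e \<gamma> (x, 0))"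
        using x xY by (intro exp_norm_least) (auto simp: e_0)
      with x show ?thesis by auto
    next
      case False
      then obtain \<rho> where \<rho>: "\<rho> > 0" "\<And>z. z \<in> Y \<inter> disc0 \<rho> \<Longrightarrow> cmod (e \<gamma> z) < cmod (e \<gamma> (x, 0))"
        using e_small_near_0[of \<gamma> "cmod (e \<gamma> (x, 0))"] e_nonzero[OF xY] assms
        by (metis zero_less_norm_iff order_le_imp_less_or_eq)
      have "exp_norm Y e (min \<rho> x) \<gamma> \<le> cmod (e \<gamma> (x, 0))"
        using \<rho> x disc0_mono[of "min \<rho> x" \<rho>] by (intro exp_norm_least less_imp_le \<rho>(2)) auto
      then show ?thesis using \<rho> x by (intro exI[of _ "min \<rho> x"]) auto
    qed
  qed
qed

lemma wm_UN:
  assumes "finite I" "\<And>i. i \<in> I \<Longrightarrow> wm (S i)" "\<And>i. i \<in> I \<Longrightarrow> S i \<subseteq> {0..}"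
  shows "wm (\<Union>i\<in>I. S i)"
  using assms by (induction I) (auto intro!: wm_Un wm_empty)

section \<open>Admissible sets\<close>

text \<open>A subset B enters the definition only through its minimum, and the set consisting of m
  alone realises every m in S.\<close>

lemma admissible_iff:
  "admissible Y e S \<longleftrightarrow> S \<subseteq> {0..} \<and> well_ordered S \<and> wm S \<and>
    (\<forall>m\<in>S. wm {\<alpha> - m | \<alpha>. \<alpha> \<in> S \<and> \<alpha> > m})"
proof -
  have "\<exists>B\<subseteq>S. m \<in> B \<and> (\<forall>b\<in>B. m \<le> b)" if "m \<in> S" for m
    using that by (intro exI[of _ "{m}"]) auto
  then show ?thesis unfolding admissible_def by blast
qed

text \<open>Admitting m itself adds only the exponent 0. The decompositions below need this, since
  one of their summands may vanish.\<close>

lemma admissible_shift: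
  assumes "admissible Y e S" "m \<in> S"
  shows "wm {\<alpha> - m | \<alpha>. \<alpha> \<in> S \<and> \<alpha> \<ge> m}"
proof -
  have "wm ({\<alpha> - m | \<alpha>. \<alpha> \<in> S \<and> \<alpha> > m} \<union> {0})"
    using assms by (intro wm_Un wm_singleton) (auto simp: admissible_iff)
  then show ?thesis by (rule wm_subset) force
qed

text \<open>Cancellation can make the support of a sum or product of series smaller than the union
  or sumset of the supports.\<close>

lemma admissible_subset:
  assumes "admissible Y e T" "S \<subseteq> T"
  shows "admissible Y e S"
  unfolding admissible_iff
proof (intro conjI ballI)
  show "S \<subseteq> {0..}" "well_ordered S" "wm S"
    using assms by (auto simp: admissible_iff intro: well_ordered_subset wm_subset)
  fix m assume "m \<in> S"
  then have "wm {\<alpha> - m | \<alpha>. \<alpha> \<in> T \<and> \<alpha> > m}"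
    using assms by (auto simp: admissible_iff)
  then show "wm {\<alpha> - m | \<alpha>. \<alpha> \<in> S \<and> \<alpha> > m}"
    by (rule wm_subset) (use assms(2) in blast)
qed

text \<open>With \<open>m'\<close> the first exponent of \<open>S\<close> beyond \<open>m\<close>, write \<open>\<alpha> - m = (\<alpha> - m') + (m' - m)\<close>.\<close>

lemma wm_shift_any:
  assumes "admissible Y e S"
  shows "wm {\<alpha> - m | \<alpha>. \<alpha> \<in> S \<and> \<alpha> > m}"
proof (cases "{\<alpha>\<in>S. \<alpha> > m} = {}")
  case True
  then show ?thesis using wm_subset[OF wm_empty, of "{\<alpha> - m | \<alpha>. \<alpha> \<in> S \<and> \<alpha> > m}"] by blast
next
  case False
  have "well_ordered {\<alpha>\<in>S. \<alpha> > m}"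
    using assms by (auto simp: admissible_iff intro: well_ordered_subset)
  then obtain m' where m': "m' \<in> {\<alpha>\<in>S. \<alpha> > m}" "\<And>b. b \<in> {\<alpha>\<in>S. \<alpha> > m} \<Longrightarrow> m' \<le> b"
    using well_ordered_min False by blast
  have "wm (sumset {\<alpha> - m' | \<alpha>. \<alpha> \<in> S \<and> \<alpha> \<ge> m'} {m' - m})"
    using m' assms by (intro wm_sumset wm_singleton admissible_shift) auto
  moreover have "{\<alpha> - m | \<alpha>. \<alpha> \<in> S \<and> \<alpha> > m} \<subseteq> sumset {\<alpha> - m' | \<alpha>. \<alpha> \<in> S \<and> \<alpha> \<ge> m'} {m' - m}"
  proof clarify
    fix \<alpha> assume "\<alpha> \<in> S" "\<alpha> > m"
    then show "\<alpha> - m \<in> sumset {\<alpha> - m' | \<alpha>. \<alpha> \<in> S \<and> \<alpha> \<ge> m'} {m' - m}"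
      unfolding sumset_def using m'(2)[of \<alpha>]
      by (intro CollectI exI[of _ "\<alpha> - m'"] exI[of _ "m' - m"]) auto
  qed
  ultimately show ?thesis by (rule wm_subset)
qed

text \<open>An exponent m of S need not occur in T, yet it also shifts the part of T above it; this
  is the case that \<open>wm_shift_any\<close> supplies.\<close>

lemma admissible_Un:
  assumes "admissible Y e S" "admissible Y e T"
  shows "admissible Y e (S \<union> T)"
  unfolding admissible_iff
proof (intro conjI ballI)
  show "S \<union> T \<subseteq> {0..}" "well_ordered (S \<union> T)" "wm (S \<union> T)"
    using assms by (auto simp: admissible_iff intro!: well_ordered_Un wm_Un)
  fix m
  have "wm ({\<alpha> - m | \<alpha>. \<alpha> \<in> S \<and> \<alpha> > m} \<union> {\<alpha> - m | \<alpha>. \<alpha> \<in> T \<and> \<alpha> > m})"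
    using assms by (intro wm_Un wm_shift_any) auto
  then show "wm {\<alpha> - m | \<alpha>. \<alpha> \<in> S \<union> T \<and> \<alpha> > m}"
    by (rule wm_subset) blast
qed

text \<open>The pairs \<open>(\<alpha>, \<beta>)\<close> with \<open>\<alpha> + \<beta> > m\<close> lie above finitely many minimal pairs \<open>(c, d)\<close>, and then
  \<open>\<alpha> + \<beta> - m = (\<alpha> - c) + (\<beta> - d) + (c + d - m)\<close>.\<close>

lemma admissible_sumset:
  assumes "admissible Y e S" "admissible Y e T"
  shows "admissible Y e (sumset S T)"
  unfolding admissible_iff
proof (intro conjI ballI)
  have ST: "S \<subseteq> {0..}" "T \<subseteq> {0..}" "well_ordered S" "well_ordered T" "wm S" "wm T"
    using assms by (auto simp: admissible_iff)
  show "sumset S T \<subseteq> {0..}"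
    by (rule sumset_nonneg[OF ST(1,2)])
  show "well_ordered (sumset S T)" "wm (sumset S T)"
    by (intro well_ordered_sumset wm_sumset ST)+
  fix m
  let ?P = "{(\<alpha>, \<beta>). \<alpha> \<in> S \<and> \<beta> \<in> T \<and> \<alpha> + \<beta> > m}"
  obtain M where M: "finite M" "M \<subseteq> ?P"
    "\<And>a b. (a, b) \<in> ?P \<Longrightarrow> \<exists>c d. (c, d) \<in> M \<and> c \<le> a \<and> d \<le> b"
    by (rule finite_minimal_pairs[OF ST(3,4), of ?P]) auto
  define U where "U = (\<lambda>(c, d). sumset (sumset {\<alpha> - c | \<alpha>. \<alpha> \<in> S \<and> \<alpha> \<ge> c} {\<beta> - d | \<beta>. \<beta> \<in> T \<and> \<beta> \<ge> d}) {c + d - m})"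
  have "wm (U p)" and "U p \<subseteq> {0..}" if pM: "p \<in> M" for p
  proof -
    obtain c d where p: "p = (c, d)" "c \<in> S" "d \<in> T" "c + d > m"
      using M(2) pM by auto
    have 1: "sumset {\<alpha> - c | \<alpha>. \<alpha> \<in> S \<and> \<alpha> \<ge> c} {\<beta> - d | \<beta>. \<beta> \<in> T \<and> \<beta> \<ge> d} \<subseteq> {0..}"
      by (intro sumset_nonneg) auto
    show "wm (U p)"
      unfolding U_def p(1) prod.case
      using p assms 1 by (intro wm_sumset wm_singleton admissible_shift) auto
    show "U p \<subseteq> {0..}"
      unfolding U_def p(1) prod.case using p(4) 1 by (intro sumset_nonneg) auto
  qed
  then have "wm (\<Union>p\<in>M. U p)"
    using M(1) by (intro wm_UN) auto
  moreover have "{\<gamma> - m | \<gamma>. \<gamma> \<in> sumset S T \<and> \<gamma> > m} \<subseteq> (\<Union>p\<in>M. U p)"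
  proof clarify
    fix \<gamma> assume \<gamma>: "\<gamma> \<in> sumset S T" "\<gamma> > m"
    then obtain a b where ab: "\<gamma> = a + b" "a \<in> S" "b \<in> T" "(a, b) \<in> ?P"
      unfolding sumset_def by blast
    obtain c d where cd: "(c, d) \<in> M" "c \<le> a" "d \<le> b" using M(3)[OF ab(4)] by blast
    have "\<gamma> - m = ((a - c) + (b - d)) + (c + d - m)"
      using ab(1) by (simp add: algebra_simps)
    then have "\<gamma> - m \<in> U (c, d)"
      unfolding U_def sumset_def using ab cd by blast
    with cd(1) show "\<gamma> - m \<in> (\<Union>p\<in>M. U p)" by blast
  qed
  ultimately show "wm {\<gamma> - m | \<gamma>. \<gamma> \<in> sumset S T \<and> \<gamma> > m}"
    by (rule wm_subset)
qed

lemma admissible_singleton: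
  assumes "\<gamma> \<ge> 0"
  shows "admissible Y e {\<gamma>}"
  unfolding admissible_iff
proof (intro conjI ballI)
  show "{\<gamma>} \<subseteq> {0..}" "wm {\<gamma>}"
    using assms wm_singleton by simp_all
  show "well_ordered {\<gamma>}"
    by (auto simp: well_ordered_def subset_singleton_iff)
  show "wm {\<alpha> - m | \<alpha>. \<alpha> \<in> {\<gamma>} \<and> \<alpha> > m}" if "m \<in> {\<gamma>}" for m
    by (rule wm_subset[OF wm_empty]) (use that in auto)
qed

end

section \<open>Functionals separating points\<close>

text \<open>Homogeneity is demanded only as an inequality for positive factors, a form that passes
  easily to infima. Applying it to the inverse factor gives equality, see
  \<open>sublinear_scale\<close>.\<close>

definition sublinear :: "('a::real_vector \<Rightarrow> real) \<Rightarrow> bool"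
  where "sublinear p \<longleftrightarrow> p 0 = 0 \<and> (\<forall>x y. p (x + y) \<le> p x + p y) \<and> (\<forall>c>0. \<forall>x. p (c *\<^sub>R x) \<le> c * p x)"

lemma sublinear_norm: "sublinear (norm :: 'a::real_normed_vector \<Rightarrow> real)"
  by (simp add: sublinear_def norm_triangle_ineq)

lemma sublinear_add: "sublinear p \<Longrightarrow> p (x + y) \<le> p x + p y"
  by (simp add: sublinear_def)

lemma sublinear_scale:
  assumes "sublinear p" "c \<ge> 0"
  shows "p (c *\<^sub>R x) = c * p x"
proof (cases "c = 0")
  case False
  with assms(2) have c: "c > 0" by simp
  then have "p (inverse c *\<^sub>R c *\<^sub>R x) \<le> inverse c * p (c *\<^sub>R x)" "p (c *\<^sub>R x) \<le> c * p x"
    using assms(1) unfolding sublinear_def by (metis positive_imp_inverse_positive)+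
  with c show ?thesis
    by (simp add: field_simps)
qed (use assms in \<open>simp add: sublinear_def\<close>)

lemma sublinear_minus: "sublinear p \<Longrightarrow> - p (- x) \<le> p x"
  using sublinear_add[of p x "- x"] by (simp add: sublinear_def)

text \<open>The modification of p used in the Hahn-Banach argument: t = 0 shows that it lies below
  p, and t = 1 shows that its value at -y is at most -p y, which pushes p towards linearity in the
  direction y.\<close>

definition sublinear_shift :: "('a::real_vector \<Rightarrow> real) \<Rightarrow> 'a \<Rightarrow> 'a \<Rightarrow> real"
  where "sublinear_shift p y z = (INF t\<in>{0..}. p (z + t *\<^sub>R y) - t * p y)"

lemma sublinear_shift_le:
  assumes "sublinear p" "t \<ge> 0"
  shows "sublinear_shift p y z \<le> p (z + t *\<^sub>R y) - t * p y"
  unfolding sublinear_shift_def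
proof (rule cINF_lower)
  show "bdd_below ((\<lambda>t. p (z + t *\<^sub>R y) - t * p y) ` {0..})"
  proof (rule bdd_belowI2)
    fix t :: real assume "t \<in> {0..}"
    then show "- p (- z) \<le> p (z + t *\<^sub>R y) - t * p y"
      using sublinear_add[OF assms(1), of "z + t *\<^sub>R y" "- z"] sublinear_scale[OF assms(1), of t y]
      by simp
  qed
qed (use assms in simp)

lemma sublinear_shift_greatest:
  assumes "\<And>t. t \<ge> 0 \<Longrightarrow> b \<le> p (z + t *\<^sub>R y) - t * p y"
  shows "b \<le> sublinear_shift p y z"
  unfolding sublinear_shift_def by (rule cINF_greatest) (use assms in auto)

lemma sublinear_shift_sublinear:
  assumes p: "sublinear p"
  shows "sublinear (sublinear_shift p y)"
  unfolding sublinear_def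
proof (intro conjI allI impI)
  show "sublinear_shift p y 0 = 0"
  proof (rule antisym)
    show "sublinear_shift p y 0 \<le> 0"
      using sublinear_shift_le[OF p, of 0 y 0] p by (simp add: sublinear_def)
    show "0 \<le> sublinear_shift p y 0"
      by (rule sublinear_shift_greatest) (simp add: sublinear_scale[OF p])
  qed
next
  fix z w
  \<comment> \<open>The two infima on the right are taken one after the other; parameters t for z
    and s for w combine to t + s for z + w.\<close>
  have "sublinear_shift p y (z + w) - (p (w + s *\<^sub>R y) - s * p y) \<le> sublinear_shift p y z" if s: "s \<ge> 0" for s
  proof (rule sublinear_shift_greatest)
    fix t :: real assume t: "t \<ge> 0"
    have "sublinear_shift p y (z + w) \<le> p (z + w + (t + s) *\<^sub>R y) - (t + s) * p y"
      using s t by (intro sublinear_shift_le p) auto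
    also have "z + w + (t + s) *\<^sub>R y = (z + t *\<^sub>R y) + (w + s *\<^sub>R y)"
      by (simp add: algebra_simps)
    also have "p \<dots> \<le> p (z + t *\<^sub>R y) + p (w + s *\<^sub>R y)"
      by (rule sublinear_add[OF p])
    finally show "sublinear_shift p y (z + w) - (p (w + s *\<^sub>R y) - s * p y) \<le> p (z + t *\<^sub>R y) - t * p y"
      by (simp add: algebra_simps)
  qed
  then have "sublinear_shift p y (z + w) - sublinear_shift p y z \<le> sublinear_shift p y w"
    by (intro sublinear_shift_greatest) (simp add: algebra_simps)
  then show "sublinear_shift p y (z + w) \<le> sublinear_shift p y z + sublinear_shift p y w"
    by simp
next
  fix c :: real and z assume c: "c > 0"
  have "sublinear_shift p y (c *\<^sub>R z) / c \<le> sublinear_shift p y z"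
  proof (rule sublinear_shift_greatest)
    fix t :: real assume t: "t \<ge> 0"
    \<comment> \<open>The parameter c * t lets the factor c be pulled out of the argument of p as a
      whole.\<close>
    have "sublinear_shift p y (c *\<^sub>R z) \<le> p (c *\<^sub>R z + (c * t) *\<^sub>R y) - (c * t) * p y"
      using c t by (intro sublinear_shift_le p) auto
    also have "c *\<^sub>R z + (c * t) *\<^sub>R y = c *\<^sub>R (z + t *\<^sub>R y)"
      by (simp add: algebra_simps)
    also have "p \<dots> = c * p (z + t *\<^sub>R y)"
      using c by (intro sublinear_scale p) auto
    finally show "sublinear_shift p y (c *\<^sub>R z) / c \<le> p (z + t *\<^sub>R y) - t * p y"
      using c by (simp add: field_simps)
  qed
  then show "sublinear_shift p y (c *\<^sub>R z) \<le> c * sublinear_shift p y z"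
    using c by (simp add: field_simps)
qed

text \<open>Zorn's lemma for the reversed pointwise order, with the pointwise infimum u bounding a
  chain. The infimum is finite because p \<le> q forces p x \<ge> - p (- x) \<ge> - q (- x).\<close>

lemma minimal_sublinear:
  fixes q :: "'a::real_vector \<Rightarrow> real"
  assumes q: "sublinear q"
  obtains l where "sublinear l" "\<And>x. l x \<le> q x"
    "\<And>p. sublinear p \<Longrightarrow> (\<And>x. p x \<le> l x) \<Longrightarrow> p = l"
proof -
  define A where "A = {p. sublinear p \<and> (\<forall>x. p x \<le> q x)}"
  define P :: "('a \<Rightarrow> real) \<Rightarrow> ('a \<Rightarrow> real) \<Rightarrow> bool" where "P = (\<lambda>p p'. \<forall>x. p' x \<le> p x)"
  have "\<exists>m\<in>A. \<forall>a\<in>A. P m a \<longrightarrow> a = m"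
  proof (rule predicate_Zorn)
    show "partial_order_on A (relation_of P A)"
      unfolding P_def
      by (rule partial_order_on_relation_ofI) (auto intro: order_trans antisym simp: fun_eq_iff)
  next
    fix C assume C: "C \<in> Chains (relation_of P A)"
    show "\<exists>u\<in>A. \<forall>a\<in>C. P a u"
    proof (cases "C = {}")
      case True
      then show ?thesis using q by (auto simp: A_def)
    next
      case False
      have CA: "p \<in> A" if "p \<in> C" for p
        using C that by (auto simp: Chains_def relation_of_def)
      have Csub: "sublinear p" and Cle: "p x \<le> q x" if "p \<in> C" for p x
        using CA[OF that] by (auto simp: A_def)
      obtain p0 where p0: "p0 \<in> C" using False by blast
      have total: "P p p' \<or> P p' p" if "p \<in> C" "p' \<in> C" for p p'
        using C that by (auto simp: Chains_def relation_of_def)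
      define u where "u x = (INF p\<in>C. p x)" for x
      have u_le: "u x \<le> p x" if "p \<in> C" for p x
        unfolding u_def
      proof (rule cINF_lower[OF _ that])
        have "- q (- x) \<le> p x" if "p \<in> C" for p
          using sublinear_minus[OF Csub[OF that], of x] Cle[OF that, of "- x"] by linarith
        then show "bdd_below ((\<lambda>p. p x) ` C)" by (rule bdd_belowI2)
      qed
      have u_ge: "b \<le> u x" if "\<And>p. p \<in> C \<Longrightarrow> b \<le> p x" for b x
        unfolding u_def by (rule cINF_greatest) (use that False in auto)
      have "sublinear u"
        unfolding sublinear_def
      proof (intro conjI allI impI)
        show "u 0 = 0"
        proof (rule antisym)
          have zero: "p 0 = 0" if "p \<in> C" for p using Csub[OF that] by (simp add: sublinear_def)
          show "u 0 \<le> 0" using u_le[OF p0, of 0] zero[OF p0] by simp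
          show "0 \<le> u 0" by (rule u_ge) (simp add: zero)
        qed
      next
        fix x y
        have "u (x + y) - p' y \<le> u x" if p': "p' \<in> C" for p'
        proof (rule u_ge)
          fix p assume p: "p \<in> C"
          \<comment> \<open>An infimum of two subadditive functions need not be subadditive. In a
            chain the smaller of p and p' serves both arguments at once.\<close>
          obtain r where r: "r \<in> C" "r x \<le> p x" "r y \<le> p' y"
            using total[OF p p'] p p' unfolding P_def by blast
          have "u (x + y) \<le> r x + r y"
            using u_le[OF r(1), of "x + y"] sublinear_add[OF Csub[OF r(1)], of x y] by linarith
          with r show "u (x + y) - p' y \<le> p x" by simp
        qed
        then have "u (x + y) - u x \<le> u y"
          by (intro u_ge) (simp add: algebra_simps)
        then show "u (x + y) \<le> u x + u y" by simp
      next
        fix c :: real and x assume c: "c > 0"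
        have "u (c *\<^sub>R x) / c \<le> u x"
        proof (rule u_ge)
          fix p assume p: "p \<in> C"
          have "u (c *\<^sub>R x) \<le> c * p x"
            using u_le[OF p, of "c *\<^sub>R x"] c sublinear_scale[OF Csub[OF p], of c x] by simp
          then show "u (c *\<^sub>R x) / c \<le> p x" using c by (simp add: field_simps)
        qed
        then show "u (c *\<^sub>R x) \<le> c * u x" using c by (simp add: field_simps)
      qed
      moreover have "u x \<le> q x" for x
        using u_le[OF p0, of x] Cle[OF p0, of x] by linarith
      ultimately have "u \<in> A" by (simp add: A_def)
      then show ?thesis using u_le unfolding P_def by blast
    qed
  qed
  then obtain l where l: "l \<in> A" "\<And>a. a \<in> A \<Longrightarrow> P l a \<Longrightarrow> a = l" by blast
  show thesis
  proof (rule that)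
    show "sublinear l" "\<And>x. l x \<le> q x" using l(1) by (auto simp: A_def)
    fix p assume "sublinear p" "\<And>x. p x \<le> l x"
    then show "p = l"
      using l by (intro l(2)) (auto simp: A_def P_def intro: order_trans)
  qed
qed

text \<open>A minimal sublinear functional is linear because it agrees with all its shifts.\<close>

lemma separating_real_functional:
  fixes x :: "'a::real_normed_vector"
  assumes "x \<noteq> 0"
  obtains l :: "'a \<Rightarrow> real" where "bounded_linear l" "l x \<noteq> 0"
proof -
  \<comment> \<open>Minimising below the shift of the norm in the direction x, and not below the
    norm itself, secures l (- x) \<le> - norm x and so l x \<noteq> 0.\<close>
  obtain l where l: "sublinear l" "\<And>z. l z \<le> sublinear_shift norm x z"
    "\<And>p. sublinear p \<Longrightarrow> (\<And>z. p z \<le> l z) \<Longrightarrow> p = l"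
    using minimal_sublinear[OF sublinear_shift_sublinear[OF sublinear_norm, of x]] by metis
  have "sublinear_shift l y = l" for y
    using sublinear_shift_le[OF l(1), of 0 y]
    by (intro l(3) sublinear_shift_sublinear l(1)) auto
  then have "l z \<le> l (z + y) - l y" for z y
    using sublinear_shift_le[OF l(1), of 1 y z] by simp
  then have add: "l (z + y) = l z + l y" for z y
    using sublinear_add[OF l(1), of z y] by (smt (verit))
  have neg: "l (- z) = - l z" for z
    using add[of z "- z"] l(1) by (simp add: sublinear_def)
  have scale: "l (c *\<^sub>R z) = c * l z" for c z
    using sublinear_scale[OF l(1), of c z] sublinear_scale[OF l(1), of "- c" z] neg[of "c *\<^sub>R z"]
    by (cases "c \<ge> 0") auto
  have le: "l z \<le> norm z" for z
    using l(2)[of z] sublinear_shift_le[OF sublinear_norm, of 0 x z] by simp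
  have "bounded_linear l"
  proof (rule bounded_linear_intro)
    show "norm (l z) \<le> norm z * 1" for z
      using le[of z] le[of "- z"] neg[of z] by (auto simp: abs_if)
  qed (use add scale in auto)
  moreover have "l (- x) \<le> - norm x"
    using l(2)[of "- x"] sublinear_shift_le[OF sublinear_norm, of 1 x "- x"] by simp
  then have "l x \<noteq> 0" using neg[of x] assms by auto
  ultimately show thesis by (rule that)
qed

section \<open>Complex functionals and the identity theorem\<close>

lemma scaleC_zero_right [simp]: "c *\<^sub>C 0 = 0"
  using scaleC_add_right[of c 0 0] by simp

lemma scaleC_one [simp]: "1 *\<^sub>C x = x"
  using scaleC_of_real[of 1 x] by simp

lemma bounded_bilinear_scaleC: "bounded_bilinear ((*\<^sub>C) :: complex \<Rightarrow> 'a \<Rightarrow> 'a::complex_banach_algebra)"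
proof
  fix a a' r and b b' :: 'a
  show "(a + a') *\<^sub>C b = a *\<^sub>C b + a' *\<^sub>C b" by (rule scaleC_add_left)
  show "a *\<^sub>C (b + b') = a *\<^sub>C b + a *\<^sub>C b'" by (rule scaleC_add_right)
  show "(r *\<^sub>R a) *\<^sub>C b = r *\<^sub>R a *\<^sub>C b"
    by (metis scaleC_of_real scaleC_scaleC scaleR_conv_of_real)
  show "a *\<^sub>C r *\<^sub>R b = r *\<^sub>R a *\<^sub>C b"
    by (metis scaleC_of_real scaleC_scaleC mult.commute)
  show "\<exists>K. \<forall>a b. norm (a *\<^sub>C b :: 'a) \<le> norm a * norm b * K"
    by (intro exI[of _ 1]) (simp add: norm_scaleC)
qed

text \<open>A complex linear functional is recovered from its real part l as y \<mapsto> l y - \<i>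
  l (\<i> y). Applied to any real functional l, the formula yields a complex linear one with real
  part l, so it still does not vanish at x.\<close>

lemma separating_complex_functional:
  fixes x :: "'a::complex_banach_algebra"
  assumes "x \<noteq> 0"
  obtains \<phi> :: "'a \<Rightarrow> complex"
  where "bounded_linear \<phi>" "\<And>c y. \<phi> (c *\<^sub>C y) = c * \<phi> y" "\<phi> x \<noteq> 0"
proof -
  obtain l :: "'a \<Rightarrow> real" where l: "bounded_linear l" "l x \<noteq> 0"
    using separating_real_functional[OF assms] .
  interpret l: bounded_linear l by fact
  define \<phi> where "\<phi> y = complex_of_real (l y) - \<i> * complex_of_real (l (\<i> *\<^sub>C y))" for y
  show thesis
  proof
    have "bounded_linear (\<lambda>y. l (\<i> *\<^sub>C y))"
      by (intro bounded_linear_compose[OF l(1)] bounded_bilinear.bounded_linear_right[OF bounded_bilinear_scaleC])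
    then show "bounded_linear \<phi>"
      unfolding \<phi>_def using l(1)
      by (intro bounded_linear_sub bounded_linear_const_mult bounded_linear_compose[OF bounded_linear_of_real])
    have "Re (\<phi> x) = l x" by (simp add: \<phi>_def)
    with l(2) show "\<phi> x \<noteq> 0" by auto
    fix c and y :: 'a
    have c: "c = complex_of_real (Re c) + complex_of_real (Im c) * \<i>"
      by (simp add: complex_eq mult.commute)
    have "c *\<^sub>C y = Re c *\<^sub>R y + Im c *\<^sub>R \<i> *\<^sub>C y"
      by (subst c) (simp only: scaleC_add_left scaleC_scaleC[symmetric] scaleC_of_real)
    then have 1: "l (c *\<^sub>C y) = Re c * l y + Im c * l (\<i> *\<^sub>C y)"
      by (simp add: l.add l.scaleR)
    have "\<i> * c = complex_of_real (Re c) * \<i> + complex_of_real (- Im c)"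
      by (simp add: complex_eq_iff)
    then have "\<i> *\<^sub>C c *\<^sub>C y = Re c *\<^sub>R \<i> *\<^sub>C y + (- Im c) *\<^sub>R y"
      by (simp only: scaleC_scaleC scaleC_add_left flip: scaleC_of_real)
    then have 2: "l (\<i> *\<^sub>C c *\<^sub>C y) = Re c * l (\<i> *\<^sub>C y) - Im c * l y"
      by (simp add: l.add l.scaleR l.diff)
    show "\<phi> (c *\<^sub>C y) = c * \<phi> y"
      unfolding \<phi>_def 1 2 by (simp add: complex_eq_iff algebra_simps)
  qed
qed

text \<open>The functional is chosen for the one value \<open>F w\<close> that is supposed nonzero.
  Its complex linearity is what makes the composition with F complex differentiable.\<close>

lemma banach_identity_theorem:
  fixes F :: "complex \<Rightarrow> 'a::complex_banach_algebra"
  assumes "open S" "connected S" "open U" "U \<noteq> {}" "U \<subseteq> S"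
    and holo: "\<And>w. w \<in> S \<Longrightarrow> \<exists>D. (F has_derivative (\<lambda>h. h *\<^sub>C D)) (at w)"
    and zero: "\<And>w. w \<in> U \<Longrightarrow> F w = 0" and w: "w \<in> S"
  shows "F w = 0"
proof (rule ccontr)
  assume "F w \<noteq> 0"
  then obtain \<phi> :: "'a \<Rightarrow> complex" where \<phi>: "bounded_linear \<phi>" "\<And>c y. \<phi> (c *\<^sub>C y) = c * \<phi> y" "\<phi> (F w) \<noteq> 0"
    using separating_complex_functional[of "F w"] by metis
  interpret \<phi>: bounded_linear \<phi> by fact
  have "(\<lambda>v. \<phi> (F v)) holomorphic_on S"
    unfolding holomorphic_on_open[OF assms(1)]
  proof
    fix v assume "v \<in> S"
    then obtain D where "(F has_derivative (\<lambda>h. h *\<^sub>C D)) (at v)" using holo by blast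
    then have "((\<lambda>v. \<phi> (F v)) has_derivative (\<lambda>h. \<phi> (h *\<^sub>C D))) (at v)"
      by (rule \<phi>.has_derivative)
    moreover have "(\<lambda>h. \<phi> (h *\<^sub>C D)) = (*) (\<phi> D)"
      by (simp add: fun_eq_iff \<phi>(2))
    ultimately show "\<exists>d. ((\<lambda>v. \<phi> (F v)) has_field_derivative d) (at v)"
      unfolding has_field_derivative_def by auto
  qed
  then have "\<phi> (F w) = 0"
    by (rule analytic_continuation_open[OF assms(3,1,4,2,5) _ holomorphic_on_const _ w])
      (simp add: zero \<phi>.zero)
  with \<phi>(3) show False by simp
qed

section \<open>Convergent Hahn series\<close>

lemma supp_eq_0: "\<gamma> \<notin> supp a \<Longrightarrow> a \<gamma> = 0"
  by (simp add: supp_def)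

lemma supp_add: "supp (\<lambda>\<gamma>. a \<gamma> + b \<gamma> :: 'r::monoid_add) \<subseteq> supp a \<union> supp b"
  by (auto simp: supp_def)

lemma supp_uminus: "supp (\<lambda>\<gamma>. - a \<gamma> :: 'r::group_add) = supp a"
  by (auto simp: supp_def)

lemma supp_hahn_mult: "supp (hahn_mult a b) \<subseteq> sumset (supp a) (supp b)"
proof
  fix \<gamma> assume "\<gamma> \<in> supp (hahn_mult a b)"
  then have "{(\<alpha>, \<beta>). \<alpha> \<in> supp a \<and> \<beta> \<in> supp b \<and> \<alpha> + \<beta> = \<gamma>} \<noteq> {}"
    unfolding supp_def[of "hahn_mult a b"] hahn_mult_def mem_Collect_eq by (metis sum.empty)
  then show "\<gamma> \<in> sumset (supp a) (supp b)"
    by (auto simp: sumset_def)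
qed

lemma countable_sumset: "countable S \<Longrightarrow> countable T \<Longrightarrow> countable (sumset S T)"
proof -
  assume "countable S" "countable T"
  then have "countable ((\<lambda>(\<alpha>, \<beta>). \<alpha> + \<beta>) ` (S \<times> T))" by auto
  moreover have "sumset S T = (\<lambda>(\<alpha>, \<beta>). \<alpha> + \<beta>) ` (S \<times> T)"
    by (auto simp: sumset_def)
  ultimately show ?thesis by simp
qed

text \<open>Series with different supports can thus be summed over one common index set.\<close>

lemma has_sum_supp_superset:
  fixes a :: "'g \<Rightarrow> 'r::complex_banach_algebra"
  assumes "supp a \<subseteq> U"
  shows "((\<lambda>\<gamma>. c \<gamma> *\<^sub>C a \<gamma>) has_sum s) (supp a) \<longleftrightarrow> ((\<lambda>\<gamma>. c \<gamma> *\<^sub>C a \<gamma>) has_sum s) U"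
  using assms by (intro has_sum_cong_neutral) (auto simp: supp_eq_0)

lemma summable_on_supp_superset:
  fixes a :: "'g \<Rightarrow> 'r::real_normed_vector"
  assumes "supp a \<subseteq> U"
  shows "(\<lambda>\<gamma>. norm (a \<gamma>) * c \<gamma> :: real) summable_on supp a \<longleftrightarrow> (\<lambda>\<gamma>. norm (a \<gamma>) * c \<gamma>) summable_on U"
  using assms by (intro summable_on_cong_neutral) (auto simp: supp_eq_0)

section \<open>Products of absolutely convergent sums\<close>

text \<open>Tagging each pair with its sum turns S \<times> T into a dependent product over
  \<open>sumset S T\<close>. Summing the fibres first is then the Cauchy product, with finite inner
  sums by \<open>finite_sum_fibre\<close>.\<close>

lemma has_sum_over_sumset:
  fixes F :: "'g::linordered_ab_group_add \<times> 'g \<Rightarrow> 'a::{topological_comm_monoid_add, t3_space}" and S T :: "'g set"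
  assumes "(F has_sum s) (S \<times> T)" "well_ordered S" "well_ordered T"
  shows "((\<lambda>\<gamma>. \<Sum>p\<in>{(\<alpha>, \<beta>). \<alpha> \<in> S \<and> \<beta> \<in> T \<and> \<alpha> + \<beta> = \<gamma>}. F p) has_sum s) (sumset S T)"
proof -
  let ?fib = "\<lambda>\<gamma>. {(\<alpha>, \<beta>). \<alpha> \<in> S \<and> \<beta> \<in> T \<and> \<alpha> + \<beta> = \<gamma>}"
  have "((\<lambda>q. F (snd q)) has_sum s) (Sigma (sumset S T) ?fib) \<longleftrightarrow> (F has_sum s) (S \<times> T)"
    by (rule has_sum_reindex_bij_witness[of _ "\<lambda>p. (fst p + snd p, p)" snd])
      (use sumset_def in force)+
  then have "((\<lambda>q. F (snd q)) has_sum s) (Sigma (sumset S T) ?fib)"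
    using assms(1) by simp
  then show ?thesis
    by (rule has_sum_SigmaD) (use finite_sum_fibre[OF assms(2,3)] in simp)
qed

lemma summable_on_mult_times:
  fixes f :: "'a \<Rightarrow> real" and g :: "'b \<Rightarrow> real"
  assumes "f summable_on S" "g summable_on T" "\<And>x. x \<in> S \<Longrightarrow> f x \<ge> 0" "\<And>y. y \<in> T \<Longrightarrow> g y \<ge> 0"
  shows "(\<lambda>(x, y). f x * g y) summable_on S \<times> T"
proof (rule summable_on_SigmaI)
  show "((\<lambda>y. case (x, y) of (x, y) \<Rightarrow> f x * g y) has_sum f x * infsum g T) T" for x
    using has_sum_cmult_right[OF has_sum_infsum[OF assms(2)], of "f x"] by simp
  show "(\<lambda>x. f x * infsum g T) summable_on S"
    by (rule summable_on_cmult_left[OF assms(1)])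
qed (use assms in auto)

text \<open>Iterated summation yields the value s * t only if the double family is known to be
  summable; this comes from the product of the norms.\<close>

lemma has_sum_mult_times:
  fixes f :: "'a \<Rightarrow> 'r::{real_normed_algebra, banach}"
  assumes "(f has_sum s) S" "(g has_sum t) T"
    and "(\<lambda>x. norm (f x)) summable_on S" "(\<lambda>x. norm (g x)) summable_on T"
  shows "((\<lambda>(x, y). f x * g y) has_sum s * t) (S \<times> T)"
proof (rule has_sum_SigmaI)
  show "((\<lambda>y. case (x, y) of (x, y) \<Rightarrow> f x * g y) has_sum f x * t) T" for x
    using has_sum_bounded_linear[OF bounded_linear_mult_right assms(2), of "f x"] by simp
  show "((\<lambda>x. f x * t) has_sum s * t) S"
    by (rule has_sum_bounded_linear[OF bounded_linear_mult_left assms(1)])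
  have "(\<lambda>p. norm (case p of (x, y) \<Rightarrow> f x * g y)) summable_on S \<times> T"
    by (rule summable_on_comparison_test[OF summable_on_mult_times[OF assms(3,4)]])
      (auto simp: norm_mult_ineq)
  then show "(\<lambda>(x, y). f x * g y) summable_on S \<times> T"
    by (rule abs_summable_summable)
qed

context exponent_system
begin

section \<open>Ring operations on convergent Hahn series\<close>

text \<open>The radius is made explicit so that two series can be brought to a common one.\<close>

definition converges_to :: "('g \<Rightarrow> 'r::complex_banach_algebra) \<Rightarrow> (cover_point \<Rightarrow> 'r) \<Rightarrow> real \<Rightarrow> bool"
  where "converges_to a h \<delta> \<longleftrightarrow> countable (supp a) \<and> admissible Y e (supp a) \<and>
    (\<lambda>\<gamma>. norm (a \<gamma>) * exp_norm Y e \<delta> \<gamma>) summable_on supp a \<and>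
    (\<forall>z\<in>Y \<inter> disc0 \<delta>. ((\<lambda>\<gamma>. e \<gamma> z *\<^sub>C a \<gamma>) has_sum h z) (supp a))"

lemma admissible_nonneg: "admissible Y e S \<Longrightarrow> \<gamma> \<in> S \<Longrightarrow> \<gamma> \<ge> 0"
  by (auto simp: admissible_iff)

lemma is_hahn_series_of_iff: "is_hahn_series_of Y e a h \<longleftrightarrow> (\<exists>\<delta>>0. converges_to a h \<delta>)"
proof -
  have "bounded (e \<gamma> ` (Y \<inter> disc0 \<delta>))" if "admissible Y e (supp a)" "\<gamma> \<in> supp a" for \<gamma> \<delta>
    using e_bdd_above[OF admissible_nonneg[OF that], of "Y \<inter> disc0 \<delta>"]
    by (force simp: bounded_iff bdd_above_def)
  then show ?thesis
    unfolding is_hahn_series_of_def normally_convergent_def converges_to_def by blast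
qed

lemma converges_to_mono:
  assumes "converges_to a h \<delta>" "0 < \<delta>'" "\<delta>' \<le> \<delta>"
  shows "converges_to a h \<delta>'"
proof -
  have adm: "admissible Y e (supp a)" using assms(1) by (simp add: converges_to_def)
  have "(\<lambda>\<gamma>. norm (a \<gamma>) * exp_norm Y e \<delta>' \<gamma>) summable_on supp a"
  proof (rule summable_on_comparison_test)
    show "(\<lambda>\<gamma>. norm (a \<gamma>) * exp_norm Y e \<delta> \<gamma>) summable_on supp a"
      using assms(1) by (simp add: converges_to_def)
    fix \<gamma> assume "\<gamma> \<in> supp a"
    then have "\<gamma> \<ge> 0" by (rule admissible_nonneg[OF adm])
    then show "norm (a \<gamma>) * exp_norm Y e \<delta>' \<gamma> \<le> norm (a \<gamma>) * exp_norm Y e \<delta> \<gamma>"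
      "0 \<le> norm (a \<gamma>) * exp_norm Y e \<delta>' \<gamma>"
      using assms by (auto intro!: mult_left_mono exp_norm_mono mult_nonneg_nonneg exp_norm_nonneg)
  qed
  moreover have "Y \<inter> disc0 \<delta>' \<subseteq> Y \<inter> disc0 \<delta>" using disc0_mono[OF assms(3)] by blast
  ultimately show ?thesis using assms(1) unfolding converges_to_def by blast
qed

lemma is_hahn_series_of_common_radius:
  assumes "is_hahn_series_of Y e a h" "is_hahn_series_of Y e b k"
  obtains \<delta> where "\<delta> > 0" "converges_to a h \<delta>" "converges_to b k \<delta>"
proof -
  obtain \<delta> \<delta>' where "\<delta> > 0" "\<delta>' > 0" "converges_to a h \<delta>" "converges_to b k \<delta>'"
    using assms unfolding is_hahn_series_of_iff by blast
  then show thesis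
    using that[of "min \<delta> \<delta>'"] converges_to_mono[of a h \<delta> "min \<delta> \<delta>'"] converges_to_mono[of b k \<delta>' "min \<delta> \<delta>'"]
    by simp
qed

text \<open>The point \<open>cover0\<close> is not in Y, so a series does not see the value there;
  that value is recovered by continuity in \<open>continuous_vanishing_at_0\<close>.\<close>

lemma is_hahn_series_of_cong:
  assumes "\<And>z. z \<in> Y \<Longrightarrow> h z = k z"
  shows "is_hahn_series_of Y e a h \<longleftrightarrow> is_hahn_series_of Y e a k"
  unfolding is_hahn_series_of_def using assms by auto

lemma is_hahn_series_of_add:
  assumes "is_hahn_series_of Y e a h" "is_hahn_series_of Y e b k"
  shows "is_hahn_series_of Y e (\<lambda>\<gamma>. a \<gamma> + b \<gamma>) (\<lambda>z. h z + k z)"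
proof -
  obtain \<delta> where \<delta>: "\<delta> > 0" and A: "converges_to a h \<delta>" and B: "converges_to b k \<delta>"
    using is_hahn_series_of_common_radius[OF assms] .
  let ?U = "supp a \<union> supp b" and ?c = "\<lambda>\<gamma>. a \<gamma> + b \<gamma>"
  have adm: "admissible Y e ?U"
    using A B by (auto simp: converges_to_def intro: admissible_Un)
  have "converges_to ?c (\<lambda>z. h z + k z) \<delta>"
    unfolding converges_to_def
  proof (intro conjI ballI)
    show "countable (supp ?c)"
      by (rule countable_subset[OF supp_add]) (use A B in \<open>simp add: converges_to_def\<close>)
    show "admissible Y e (supp ?c)"
      by (rule admissible_subset[OF adm supp_add])
    have "(\<lambda>\<gamma>. norm (a \<gamma>) * exp_norm Y e \<delta> \<gamma> + norm (b \<gamma>) * exp_norm Y e \<delta> \<gamma>) summable_on ?U"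
      using A B by (intro summable_on_add)
        (simp_all add: converges_to_def summable_on_supp_superset[of _ ?U])
    then have "(\<lambda>\<gamma>. norm (?c \<gamma>) * exp_norm Y e \<delta> \<gamma>) summable_on ?U"
    proof (rule summable_on_comparison_test)
      fix \<gamma> assume "\<gamma> \<in> ?U"
      then have E: "exp_norm Y e \<delta> \<gamma> \<ge> 0"
        using exp_norm_nonneg[OF \<delta>] admissible_nonneg[OF adm] by blast
      show "norm (?c \<gamma>) * exp_norm Y e \<delta> \<gamma> \<le> norm (a \<gamma>) * exp_norm Y e \<delta> \<gamma> + norm (b \<gamma>) * exp_norm Y e \<delta> \<gamma>"
        using mult_right_mono[OF norm_triangle_ineq E, of "a \<gamma>" "b \<gamma>"] by (simp add: distrib_right)
      show "0 \<le> norm (?c \<gamma>) * exp_norm Y e \<delta> \<gamma>" using E by simp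
    qed
    then show "(\<lambda>\<gamma>. norm (?c \<gamma>) * exp_norm Y e \<delta> \<gamma>) summable_on supp ?c"
      using summable_on_supp_superset[OF supp_add, of a b] by blast
    fix z assume z: "z \<in> Y \<inter> disc0 \<delta>"
    have "((\<lambda>\<gamma>. e \<gamma> z *\<^sub>C a \<gamma> + e \<gamma> z *\<^sub>C b \<gamma>) has_sum h z + k z) ?U"
      using A B z by (intro has_sum_add)
        (simp_all add: converges_to_def has_sum_supp_superset[of _ ?U])
    then show "((\<lambda>\<gamma>. e \<gamma> z *\<^sub>C ?c \<gamma>) has_sum h z + k z) (supp ?c)"
      unfolding has_sum_supp_superset[OF supp_add, of "\<lambda>\<gamma>. e \<gamma> z"] by (simp add: scaleC_add_right)
  qed
  with \<delta> show ?thesis unfolding is_hahn_series_of_iff by blast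
qed

lemma is_hahn_series_of_uminus:
  fixes a :: "'g \<Rightarrow> 'r::complex_banach_algebra"
  assumes "is_hahn_series_of Y e a h"
  shows "is_hahn_series_of Y e (\<lambda>\<gamma>. - a \<gamma>) (\<lambda>z. - h z)"
proof -
  have "c *\<^sub>C (- x) = - (c *\<^sub>C x)" for c and x :: 'r
    using scaleC_add_right[of c x "- x"] by (simp add: eq_neg_iff_add_eq_0 add.commute)
  then show ?thesis
    using assms unfolding is_hahn_series_of_def normally_convergent_def supp_uminus
    by (simp add: has_sum_uminus) blast
qed

lemma is_hahn_series_of_const: "is_hahn_series_of Y e (\<lambda>\<gamma>. if \<gamma> = 0 then u else 0) (\<lambda>_. u)"
proof -
  let ?a = "\<lambda>\<gamma>::'g. if \<gamma> = 0 then u else 0"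
  \<comment> \<open>Only an inclusion, because u may be 0.\<close>
  have sub: "supp ?a \<subseteq> {0}" by (auto simp: supp_def)
  have "converges_to ?a (\<lambda>_. u) 1"
    unfolding converges_to_def
  proof (intro conjI ballI)
    show "countable (supp ?a)" using sub by (rule countable_subset) simp
    show "admissible Y e (supp ?a)" by (rule admissible_subset[OF admissible_singleton sub]) simp
    show "(\<lambda>\<gamma>. norm (?a \<gamma>) * exp_norm Y e 1 \<gamma>) summable_on supp ?a"
      unfolding summable_on_supp_superset[OF sub] by (rule summable_on_finite) simp
    fix z assume "z \<in> Y \<inter> disc0 1"
    then show "((\<lambda>\<gamma>. e \<gamma> z *\<^sub>C ?a \<gamma>) has_sum u) (supp ?a)"
      unfolding has_sum_supp_superset[OF sub] by (intro has_sum_finiteI) (simp_all add: e_0)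
  qed
  then show ?thesis unfolding is_hahn_series_of_iff by (intro exI[of _ 1]) simp
qed

text \<open>The regrouping along \<alpha> + \<beta> = \<gamma> is made twice: for the majorants,
  where submultiplicativity of \<open>exp_norm\<close> gives normal convergence of the product, and
  for the values at each z, where multiplicativity of \<open>e\<close> identifies the sum.\<close>

lemma is_hahn_series_of_mult:
  fixes a b :: "'g \<Rightarrow> 'r::complex_banach_algebra"
  assumes "is_hahn_series_of Y e a h" "is_hahn_series_of Y e b k"
  shows "is_hahn_series_of Y e (hahn_mult a b) (\<lambda>z. h z * k z)"
proof -
  obtain \<delta> where \<delta>: "\<delta> > 0" and A: "converges_to a h \<delta>" and B: "converges_to b k \<delta>"
    using is_hahn_series_of_common_radius[OF assms] .
  let ?S = "supp a" and ?T = "supp b" and ?c = "hahn_mult a b" and ?E = "exp_norm Y e \<delta>"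
  let ?fib = "\<lambda>\<gamma>. {(\<alpha>, \<beta>). \<alpha> \<in> ?S \<and> \<beta> \<in> ?T \<and> \<alpha> + \<beta> = \<gamma>}"
  have adm: "admissible Y e ?S" "admissible Y e ?T"
    using A B by (auto simp: converges_to_def)
  have wo: "well_ordered ?S" "well_ordered ?T"
    using adm by (auto simp: admissible_iff)
  have E0: "?E \<gamma> \<ge> 0" if "\<gamma> \<in> ?S \<or> \<gamma> \<in> ?T" for \<gamma>
    using that exp_norm_nonneg[OF \<delta>] admissible_nonneg[OF adm(1)] admissible_nonneg[OF adm(2)] by blast
  have sumA: "(\<lambda>\<gamma>. norm (a \<gamma>) * ?E \<gamma>) summable_on ?S" and sumB: "(\<lambda>\<gamma>. norm (b \<gamma>) * ?E \<gamma>) summable_on ?T"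
    using A B by (auto simp: converges_to_def)
  have "converges_to ?c (\<lambda>z. h z * k z) \<delta>"
    unfolding converges_to_def
  proof (intro conjI ballI)
    show "countable (supp ?c)"
      by (rule countable_subset[OF supp_hahn_mult countable_sumset])
        (use A B in \<open>simp_all add: converges_to_def\<close>)
    show "admissible Y e (supp ?c)"
      by (rule admissible_subset[OF admissible_sumset[OF adm] supp_hahn_mult])
    let ?F = "\<lambda>(\<alpha>, \<beta>). (norm (a \<alpha>) * ?E \<alpha>) * (norm (b \<beta>) * ?E \<beta>)"
    have "?F summable_on ?S \<times> ?T"
      by (rule summable_on_mult_times[OF sumA sumB]) (use E0 in auto)
    then have "(\<lambda>\<gamma>. \<Sum>p\<in>?fib \<gamma>. ?F p) summable_on sumset ?S ?T"
      using has_sum_over_sumset[OF has_sum_infsum wo] summable_on_def by blast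
    then have "(\<lambda>\<gamma>. norm (?c \<gamma>) * ?E \<gamma>) summable_on sumset ?S ?T"
    proof (rule summable_on_comparison_test)
      fix \<gamma> assume \<gamma>: "\<gamma> \<in> sumset ?S ?T"
      then have "\<gamma> \<ge> 0"
        using sumset_nonneg[of ?S ?T] adm by (auto simp: admissible_iff)
      then have E: "?E \<gamma> \<ge> 0" by (rule exp_norm_nonneg[OF \<delta>])
      then show "0 \<le> norm (?c \<gamma>) * ?E \<gamma>" by simp
      have "norm (?c \<gamma>) * ?E \<gamma> \<le> (\<Sum>(\<alpha>, \<beta>)\<in>?fib \<gamma>. norm (a \<alpha> * b \<beta>)) * ?E \<gamma>"
        unfolding hahn_mult_def by (intro mult_right_mono[OF _ E] sum_norm_le) auto
      also have "\<dots> = (\<Sum>(\<alpha>, \<beta>)\<in>?fib \<gamma>. norm (a \<alpha> * b \<beta>) * ?E \<gamma>)"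
        by (simp add: sum_distrib_right case_prod_unfold)
      also have "\<dots> \<le> (\<Sum>p\<in>?fib \<gamma>. ?F p)"
      proof (rule sum_mono, clarify)
        fix \<alpha> \<beta> assume *: "\<alpha> \<in> ?S" "\<beta> \<in> ?T" "\<gamma> = \<alpha> + \<beta>"
        have "norm (a \<alpha> * b \<beta>) * ?E (\<alpha> + \<beta>) \<le> (norm (a \<alpha>) * norm (b \<beta>)) * (?E \<alpha> * ?E \<beta>)"
        proof (rule mult_mono)
          show "norm (a \<alpha> * b \<beta>) \<le> norm (a \<alpha>) * norm (b \<beta>)" by (rule norm_mult_ineq)
          show "?E (\<alpha> + \<beta>) \<le> ?E \<alpha> * ?E \<beta>"
            by (rule exp_norm_add[OF \<delta> admissible_nonneg[OF adm(1) *(1)] admissible_nonneg[OF adm(2) *(2)]])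
          show "0 \<le> ?E (\<alpha> + \<beta>)" using E *(3) by simp
        qed simp
        then show "norm (a \<alpha> * b \<beta>) * ?E (\<alpha> + \<beta>) \<le> norm (a \<alpha>) * ?E \<alpha> * (norm (b \<beta>) * ?E \<beta>)"
          by (simp add: mult_ac)
      qed
      finally show "norm (?c \<gamma>) * ?E \<gamma> \<le> (\<Sum>p\<in>?fib \<gamma>. ?F p)" .
    qed
    then show "(\<lambda>\<gamma>. norm (?c \<gamma>) * ?E \<gamma>) summable_on supp ?c"
      using summable_on_supp_superset[OF supp_hahn_mult] by blast
    fix z assume z: "z \<in> Y \<inter> disc0 \<delta>"
    let ?G = "\<lambda>(\<alpha>, \<beta>). (e \<alpha> z *\<^sub>C a \<alpha>) * (e \<beta> z *\<^sub>C b \<beta>)"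
    have bound: "norm (e \<gamma> z *\<^sub>C d \<gamma>) \<le> norm (d \<gamma>) * ?E \<gamma>" if "\<gamma> \<in> ?S \<or> \<gamma> \<in> ?T" for \<gamma> and d :: "'g \<Rightarrow> 'r"
      using that exp_norm_upper[OF _ z, of \<gamma>] admissible_nonneg[OF adm(1), of \<gamma>] admissible_nonneg[OF adm(2), of \<gamma>]
      by (auto simp: norm_scaleC mult.commute intro!: mult_left_mono)
    have "(?G has_sum h z * k z) (?S \<times> ?T)"
    proof (rule has_sum_mult_times)
      show "((\<lambda>\<gamma>. e \<gamma> z *\<^sub>C a \<gamma>) has_sum h z) ?S" "((\<lambda>\<gamma>. e \<gamma> z *\<^sub>C b \<gamma>) has_sum k z) ?T"
        using A B z by (auto simp: converges_to_def)
      show "(\<lambda>\<gamma>. norm (e \<gamma> z *\<^sub>C a \<gamma>)) summable_on ?S" "(\<lambda>\<gamma>. norm (e \<gamma> z *\<^sub>C b \<gamma>)) summable_on ?T"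
        by (rule summable_on_comparison_test[OF sumA] summable_on_comparison_test[OF sumB];
            use bound in auto)+
    qed
    then have "((\<lambda>\<gamma>. \<Sum>p\<in>?fib \<gamma>. ?G p) has_sum h z * k z) (sumset ?S ?T)"
      by (rule has_sum_over_sumset[OF _ wo])
    moreover have "(\<Sum>p\<in>?fib \<gamma>. ?G p) = e \<gamma> z *\<^sub>C ?c \<gamma>" for \<gamma>
    proof -
      have "(\<Sum>p\<in>?fib \<gamma>. ?G p) = (\<Sum>(\<alpha>, \<beta>)\<in>?fib \<gamma>. e \<gamma> z *\<^sub>C (a \<alpha> * b \<beta>))"
        using z by (intro sum.cong) (auto simp: mult_scaleC_left mult_scaleC_right scaleC_scaleC e_add mult.commute)
      also have "\<dots> = e \<gamma> z *\<^sub>C ?c \<gamma>"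
        unfolding hahn_mult_def
        by (simp add: bounded_bilinear.sum_right[OF bounded_bilinear_scaleC] case_prod_unfold)
      finally show ?thesis .
    qed
    ultimately show "((\<lambda>\<gamma>. e \<gamma> z *\<^sub>C ?c \<gamma>) has_sum h z * k z) (supp ?c)"
      unfolding has_sum_supp_superset[OF supp_hahn_mult] by simp
  qed
  with \<delta> show ?thesis unfolding is_hahn_series_of_iff by blast
qed

section \<open>Uniqueness of the Hahn series\<close>

lemma hahn_series_of_zero_unique:
  fixes c :: "'g \<Rightarrow> 'r::complex_banach_algebra"
  assumes "is_hahn_series_of Y e c (\<lambda>_. 0)"
  shows "c = (\<lambda>_. 0)"
proof (rule ccontr)
  assume "c \<noteq> (\<lambda>_. 0)"
  then have ne: "supp c \<noteq> {}" by (auto simp: supp_def)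
  obtain \<delta> where \<delta>: "\<delta> > 0" and C: "converges_to c (\<lambda>_. 0) \<delta>"
    using assms unfolding is_hahn_series_of_iff by blast
  let ?S = "supp c"
  have adm: "admissible Y e ?S" using C by (simp add: converges_to_def)
  obtain m where m: "m \<in> ?S" "\<And>b. b \<in> ?S \<Longrightarrow> m \<le> b"
    using well_ordered_min[of ?S] adm ne by (auto simp: admissible_iff)
  let ?T = "?S - {m}"
  have gt: "m < \<alpha>" if "\<alpha> \<in> ?T" for \<alpha> using m(2)[of \<alpha>] that by auto
  obtain r where r: "r > 0" "\<And>x. 0 < x \<Longrightarrow> x < r \<Longrightarrow> (x, 0) \<in> Y \<and> (\<exists>\<rho>. 0 < \<rho> \<and> \<rho> \<le> x \<and>
      (\<forall>\<alpha>\<in>{\<alpha> - m | \<alpha>. \<alpha> \<in> ?S \<and> \<alpha> > m}. exp_norm Y e \<rho> \<alpha> \<le> cmod (e \<alpha> (x, 0))))"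
    using wm_shift_any[OF adm, of m] unfolding weakly_monotonous_def by blast
  obtain x where x: "0 < x" "x < min r \<delta>" "(x, 0) \<in> Y" "(x, 0) \<in> Y \<inter> disc0 (min r \<delta>)"
    using Y_disc0_nonempty[of "min r \<delta>"] r(1) \<delta> by (metis min_less_iff_conj)
  have x\<delta>: "(x, 0) \<in> Y \<inter> disc0 \<delta>" using x disc0_mono[of "min r \<delta>" \<delta>] by auto
  obtain \<rho> where \<rho>: "\<rho> > 0" "\<rho> \<le> x"
    "\<And>\<alpha>. \<alpha> \<in> ?T \<Longrightarrow> exp_norm Y e \<rho> (\<alpha> - m) \<le> cmod (e (\<alpha> - m) (x, 0))"
  proof -
    obtain \<rho> where "\<rho> > 0" "\<rho> \<le> x"
      "\<forall>\<alpha>\<in>{\<alpha> - m | \<alpha>. \<alpha> \<in> ?S \<and> \<alpha> > m}. exp_norm Y e \<rho> \<alpha> \<le> cmod (e \<alpha> (x, 0))"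
      using r(2)[of x] x by auto
    then show thesis using gt by (intro that[of \<rho>]) auto
  qed
  \<comment> \<open>The majorant of the divided series on the whole disc of radius \<rho>. It is
    summable because weak monotonicity bounds it by the terms at x, which are terms of the original
    series divided by the fixed number \<open>e m (x, 0)\<close>.\<close>
  define K where "K \<alpha> = norm (c \<alpha>) * exp_norm Y e \<rho> (\<alpha> - m)" for \<alpha>
  have quot: "e (\<alpha> - m) z = e \<alpha> z / e m z" if "z \<in> Y" for \<alpha> z
    using e_add[OF that, of "\<alpha> - m" m] e_nonzero[OF that, of m] by simp
  have "(\<lambda>\<gamma>. norm (c \<gamma>) * exp_norm Y e \<delta> \<gamma>) summable_on ?T"
    by (rule summable_on_subset_banach[of _ ?S]) (use C in \<open>auto simp: converges_to_def\<close>)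
  then have "(\<lambda>\<gamma>. norm (c \<gamma>) * exp_norm Y e \<delta> \<gamma> * inverse (cmod (e m (x, 0)))) summable_on ?T"
    by (rule summable_on_cmult_left)
  then have "K summable_on ?T"
  proof (rule summable_on_comparison_test)
    fix \<alpha> assume \<alpha>: "\<alpha> \<in> ?T"
    have "K \<alpha> \<le> norm (c \<alpha>) * cmod (e (\<alpha> - m) (x, 0))"
      unfolding K_def using \<rho>(3)[OF \<alpha>] by (intro mult_left_mono) auto
    also have "\<dots> = norm (c \<alpha>) * cmod (e \<alpha> (x, 0)) * inverse (cmod (e m (x, 0)))"
      using quot[OF x(3)] by (simp add: norm_divide divide_inverse norm_mult norm_inverse)
    also have "\<dots> \<le> norm (c \<alpha>) * exp_norm Y e \<delta> \<alpha> * inverse (cmod (e m (x, 0)))"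
      using \<alpha> admissible_nonneg[OF adm, of \<alpha>] x\<delta>
      by (intro mult_right_mono mult_left_mono exp_norm_upper) auto
    finally show "K \<alpha> \<le> norm (c \<alpha>) * exp_norm Y e \<delta> \<alpha> * inverse (cmod (e m (x, 0)))" .
    show "0 \<le> K \<alpha>"
      unfolding K_def using gt[OF \<alpha>] \<rho>(1) by (intro mult_nonneg_nonneg exp_norm_nonneg) auto
  qed
  then obtain L where L: "(K has_sum L) ?T" by (auto simp: summable_on_def)
  \<comment> \<open>After division, c m plus a finite sum plus a tail equals 0. The finite sum and
    the tail are each made at most a third of norm (c m), which is impossible for c m \<noteq>
    0.\<close>
  have \<epsilon>: "norm (c m) / 3 > 0" using m(1) by (simp add: supp_def)
  obtain F where F: "finite F" "F \<subseteq> ?T" "dist (sum K F) L \<le> norm (c m) / 3"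
    using has_sum_finite_approximation[OF L \<epsilon>] by blast
  have tail: "(K has_sum (L - sum K F)) (?T - F)"
    by (rule has_sum_Diff[OF L has_sum_finite[OF F(1)] F(2)])
  have "((\<lambda>z. \<Sum>\<alpha>\<in>F. norm (c \<alpha>) * cmod (e (\<alpha> - m) z)) \<longlongrightarrow> (\<Sum>\<alpha>\<in>F. norm (c \<alpha>) * 0))
      (atin_within log_cover0_top cover0 Y)"
    using F(2) gt by (intro tendsto_sum tendsto_mult tendsto_const e_tendsto_0) auto
  then have "eventually (\<lambda>z. (\<Sum>\<alpha>\<in>F. norm (c \<alpha>) * cmod (e (\<alpha> - m) z)) < norm (c m) / 3)
      (atin_within log_cover0_top cover0 Y)"
    by (rule order_tendstoD) (use \<epsilon> in simp)
  then obtain \<sigma> where \<sigma>: "\<sigma> > 0"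
    "\<And>z. z \<in> Y \<inter> disc0 \<sigma> \<Longrightarrow> (\<Sum>\<alpha>\<in>F. norm (c \<alpha>) * cmod (e (\<alpha> - m) z)) < norm (c m) / 3"
    using eventually_near_0 by blast
  \<comment> \<open>The radius \<rho> keeps the tail under its majorant, and \<sigma> keeps the
    finite part small.\<close>
  obtain y where y: "(y, 0) \<in> Y" "(y, 0) \<in> Y \<inter> disc0 (min \<rho> \<sigma>)"
    using Y_disc0_nonempty[of "min \<rho> \<sigma>"] \<rho>(1) \<sigma>(1) by (metis min_less_iff_conj)
  define z :: cover_point where "z = (y, 0)"
  have zY: "z \<in> Y" and z\<rho>: "z \<in> Y \<inter> disc0 \<rho>" and z\<sigma>: "z \<in> Y \<inter> disc0 \<sigma>"
    using y disc0_mono[of "min \<rho> \<sigma>" \<rho>] disc0_mono[of "min \<rho> \<sigma>" \<sigma>] by (auto simp: z_def)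
  have z\<delta>: "z \<in> Y \<inter> disc0 \<delta>"
    using z\<rho> disc0_mono[of \<rho> \<delta>] \<rho>(2) x(2) by auto
  let ?f = "\<lambda>\<alpha>. e (\<alpha> - m) z *\<^sub>C c \<alpha>"
  have "((\<lambda>\<alpha>. inverse (e m z) *\<^sub>C e \<alpha> z *\<^sub>C c \<alpha>) has_sum inverse (e m z) *\<^sub>C 0) ?S"
    using C z\<delta>
    by (intro has_sum_bounded_linear[OF bounded_bilinear.bounded_linear_right[OF bounded_bilinear_scaleC]])
      (auto simp: converges_to_def)
  then have "(?f has_sum 0) ?S"
    using quot[OF zY] by (simp add: scaleC_scaleC divide_inverse mult.commute)
  then have "(?f has_sum (0 - sum ?f (insert m F))) (?S - insert m F)"
    by (rule has_sum_Diff[OF _ has_sum_finite]) (use F m in auto)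
  moreover have "?S - insert m F = ?T - F" by auto
  moreover have "sum ?f (insert m F) = c m + sum ?f F"
    using F(1,2) zY by (subst sum.insert) (auto simp: e_0)
  ultimately have "(?f has_sum - (c m + sum ?f F)) (?T - F)" by simp
  then have "norm (- (c m + sum ?f F)) \<le> L - sum K F"
  proof (rule norm_infsum_le[OF _ tail])
    fix \<alpha> assume "\<alpha> \<in> ?T - F"
    then have "cmod (e (\<alpha> - m) z) \<le> exp_norm Y e \<rho> (\<alpha> - m)"
      using gt[of \<alpha>] z\<rho> by (intro exp_norm_upper) auto
    then show "norm (?f \<alpha>) \<le> K \<alpha>"
      unfolding K_def norm_scaleC by (simp add: mult.commute mult_left_mono)
  qed
  also have "\<dots> \<le> norm (c m) / 3" using F(3) unfolding dist_real_def by linarith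
  finally have 1: "norm (c m + sum ?f F) \<le> norm (c m) / 3" unfolding norm_minus_cancel .
  have "norm (sum ?f F) \<le> (\<Sum>\<alpha>\<in>F. norm (c \<alpha>) * cmod (e (\<alpha> - m) z))"
    by (rule sum_norm_le) (simp add: norm_scaleC mult.commute)
  also have "\<dots> < norm (c m) / 3" by (rule \<sigma>(2)[OF z\<sigma>])
  finally have "norm (sum ?f F) < norm (c m) / 3" .
  moreover have "norm (c m) \<le> norm (c m + sum ?f F) + norm (sum ?f F)"
    using norm_triangle_ineq4[of "c m + sum ?f F" "sum ?f F"] by simp
  ultimately show False using 1 \<epsilon> by linarith
qed

lemma is_hahn_series_of_unique:
  fixes a b :: "'g \<Rightarrow> 'r::complex_banach_algebra"
  assumes "is_hahn_series_of Y e a h" "is_hahn_series_of Y e b h"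
  shows "a = b"
proof -
  have "is_hahn_series_of Y e (\<lambda>\<gamma>. a \<gamma> + - b \<gamma>) (\<lambda>z. h z + - h z)"
    by (intro is_hahn_series_of_add is_hahn_series_of_uminus assms)
  then have "(\<lambda>\<gamma>. a \<gamma> + - b \<gamma>) = (\<lambda>_. 0)"
    by (intro hahn_series_of_zero_unique) simp
  then show ?thesis by (simp add: fun_eq_iff)
qed

lemma hahn_series_of_eq: "is_hahn_series_of Y e a h \<Longrightarrow> hahn_series_of Y e h = a"
  unfolding hahn_series_of_def using is_hahn_series_of_unique by blast

end

section \<open>Holomorphic functions on the cover\<close>

lemma cover_holomorphic_cong:
  assumes "open Y" "cover_holomorphic Y f" "\<And>z. z \<in> Y \<Longrightarrow> f z = g z"
  shows "cover_holomorphic Y g"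
  unfolding cover_holomorphic_def
proof (intro allI impI)
  fix w assume w: "cover_exp w \<in> Y"
  then obtain D where D: "((f \<circ> cover_exp) has_derivative (\<lambda>h. h *\<^sub>C D)) (at w)"
    using assms(2) unfolding cover_holomorphic_def by blast
  have "open (cover_exp -` Y)"
    by (rule open_vimage[OF assms(1)]) (auto simp: cover_exp_def intro!: continuous_intros)
  then have "((g \<circ> cover_exp) has_derivative (\<lambda>h. h *\<^sub>C D)) (at w)"
    by (rule has_derivative_transform_within_open[OF D]) (use w assms(3) in auto)
  then show "\<exists>D. ((g \<circ> cover_exp) has_derivative (\<lambda>h. h *\<^sub>C D)) (at w)" by blast
qed

lemma cover_holomorphic_const: "cover_holomorphic Y (\<lambda>_. u)"
  unfolding cover_holomorphic_def by (auto intro!: exI[of _ 0])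

lemma cover_holomorphic_add:
  assumes "cover_holomorphic Y f" "cover_holomorphic Y g"
  shows "cover_holomorphic Y (\<lambda>z. f z + g z)"
  unfolding cover_holomorphic_def
proof (intro allI impI)
  fix w assume "cover_exp w \<in> Y"
  then obtain D1 D2 where "((f \<circ> cover_exp) has_derivative (\<lambda>h. h *\<^sub>C D1)) (at w)"
    "((g \<circ> cover_exp) has_derivative (\<lambda>h. h *\<^sub>C D2)) (at w)"
    using assms unfolding cover_holomorphic_def by blast
  from has_derivative_add[OF this]
  have "(((\<lambda>z. f z + g z) \<circ> cover_exp) has_derivative (\<lambda>h. h *\<^sub>C (D1 + D2))) (at w)"
    by (simp add: o_def scaleC_add_right)
  then show "\<exists>D. (((\<lambda>z. f z + g z) \<circ> cover_exp) has_derivative (\<lambda>h. h *\<^sub>C D)) (at w)" by blast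
qed

lemma cover_holomorphic_mult:
  assumes "cover_holomorphic Y f" "cover_holomorphic Y g"
  shows "cover_holomorphic Y (\<lambda>z. f z * g z)"
  unfolding cover_holomorphic_def
proof (intro allI impI)
  fix w assume "cover_exp w \<in> Y"
  then obtain D1 D2 where "((f \<circ> cover_exp) has_derivative (\<lambda>h. h *\<^sub>C D1)) (at w)"
    "((g \<circ> cover_exp) has_derivative (\<lambda>h. h *\<^sub>C D2)) (at w)"
    using assms unfolding cover_holomorphic_def by blast
  from bounded_bilinear.FDERIV[OF bounded_bilinear_mult this]
  have "(((\<lambda>z. f z * g z) \<circ> cover_exp) has_derivative
      (\<lambda>h. h *\<^sub>C (f (cover_exp w) * D2 + D1 * g (cover_exp w)))) (at w)"
    by (simp add: o_def scaleC_add_right mult_scaleC_left mult_scaleC_right)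
  then show "\<exists>D. (((\<lambda>z. f z * g z) \<circ> cover_exp) has_derivative (\<lambda>h. h *\<^sub>C D)) (at w)" by blast
qed

lemma cover_holomorphic_uminus:
  assumes "cover_holomorphic Y f"
  shows "cover_holomorphic Y (\<lambda>z. - f z)"
  unfolding cover_holomorphic_def
proof (intro allI impI)
  fix w assume "cover_exp w \<in> Y"
  then obtain D where "((f \<circ> cover_exp) has_derivative (\<lambda>h. h *\<^sub>C D)) (at w)"
    using assms unfolding cover_holomorphic_def by blast
  from has_derivative_minus[OF this]
  have "(((\<lambda>z. - f z) \<circ> cover_exp) has_derivative (\<lambda>h. h *\<^sub>C (- D))) (at w)"
    by (simp add: o_def bounded_bilinear.minus_right[OF bounded_bilinear_scaleC])
  then show "\<exists>D. (((\<lambda>z. - f z) \<circ> cover_exp) has_derivative (\<lambda>h. h *\<^sub>C D)) (at w)" by blast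
qed

text \<open>The image is a preimage under the inverse chart \<open>?L\<close>. Balls in the chart
  thereby become neighbourhoods on the cover.\<close>

lemma open_cover_exp_image:
  assumes "open U"
  shows "open (cover_exp ` U)"
proof -
  let ?L = "\<lambda>z::cover_point. Complex (ln (fst z)) (snd z)"
  have "cover_exp ` U = log_cover \<inter> ?L -` U"
  proof (intro equalityI subsetI)
    fix z assume z: "z \<in> log_cover \<inter> ?L -` U"
    then have "z = cover_exp (?L z)" by (auto simp: cover_exp_def log_cover_def)
    with z show "z \<in> cover_exp ` U" by blast
  qed (auto simp: cover_exp_def log_cover_def)
  moreover have "continuous_on log_cover ?L"
    unfolding Complex_eq log_cover_def by (intro continuous_intros) auto
  ultimately show ?thesis
    using continuous_on_open_vimage[OF open_log_cover] assms by (metis Int_commute)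
qed

lemma continuous_map_mult_algebra:
  fixes f g :: "'a \<Rightarrow> 'b::real_normed_algebra"
  shows "continuous_map X euclidean f \<Longrightarrow> continuous_map X euclidean g \<Longrightarrow>
    continuous_map X euclidean (\<lambda>x. f x * g x)"
  by (simp add: continuous_map_atin tendsto_mult)

context exponent_system
begin

abbreviation "Y0 \<equiv> insert cover0 Y"
abbreviation "Y0_top \<equiv> subtopology log_cover0_top Y0"

lemma topspace_Y0_top: "topspace Y0_top = Y0"
  using Y_subset by (auto simp: topspace_log_cover0_top)

section \<open>From the germ at 0 to all of \<open>Y0\<close>\<close>

text \<open>Y may fall into several components held together only by the point 0, so the open-closed
  argument is run in \<open>Y0\<close>: the set A of points near which d vanishes is joined with the
  disc, on which d vanishes anyway, and Y - A is the complementary open part.\<close>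

lemma vanishing_near_0:
  fixes d :: "cover_point \<Rightarrow> 'r::complex_banach_algebra"
  assumes conn: "connectedin log_cover0_top Y0" and holo: "cover_holomorphic Y d"
    and "\<delta> > 0" and zero: "\<And>z. z \<in> Y \<inter> disc0 \<delta> \<Longrightarrow> d z = 0" and z: "z \<in> Y"
  shows "d z = 0"
proof -
  define A where "A = {z\<in>Y. \<exists>N. open N \<and> z \<in> N \<and> N \<subseteq> Y \<and> (\<forall>y\<in>N. d y = 0)}"
  have openA: "open A"
    unfolding open_subopen[of A] by (fastforce simp: A_def)
  \<comment> \<open>By the identity theorem a ball in the chart lies in A as soon as it meets A;
    otherwise it misses A, which makes Y - A open.\<close>
  have near: "\<exists>N. open N \<and> z \<in> N \<and> N \<subseteq> Y \<and> (N \<inter> A \<noteq> {} \<longrightarrow> N \<subseteq> A)" if zY: "z \<in> Y" for z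
  proof -
    obtain w where w: "z = cover_exp w"
      using zY Y_subset log_cover_eq_range_cover_exp by blast
    have "open (cover_exp -` Y)"
      by (rule open_vimage[OF Y_open]) (auto simp: cover_exp_def intro!: continuous_intros)
    then obtain r where r: "r > 0" "ball w r \<subseteq> cover_exp -` Y"
      using zY w by (meson open_contains_ball vimageI)
    let ?N = "cover_exp ` ball w r"
    have N: "open ?N" "z \<in> ?N" "?N \<subseteq> Y"
      using r w by (auto intro: open_cover_exp_image)
    have "?N \<subseteq> A" if ne: "?N \<inter> A \<noteq> {}"
    proof -
      have "(d \<circ> cover_exp) v = 0" if v: "v \<in> ball w r" for v
      proof (rule banach_identity_theorem[OF _ _ _ _ _ _ _ v])
        let ?U = "ball w r \<inter> cover_exp -` A"
        show "open ?U"
          by (intro open_Int open_vimage[OF openA]) (auto simp: cover_exp_def intro!: continuous_intros)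
        show "?U \<noteq> {}" using ne by auto
        show "(d \<circ> cover_exp) u = 0" if "u \<in> ?U" for u
          using that by (auto simp: A_def)
        show "\<exists>D. ((d \<circ> cover_exp) has_derivative (\<lambda>h. h *\<^sub>C D)) (at u)" if "u \<in> ball w r" for u
          using that r(2) holo unfolding cover_holomorphic_def by blast
      qed auto
      then show ?thesis using N unfolding A_def by auto
    qed
    then show ?thesis using N by blast
  qed
  have openV: "open (Y - A)"
    unfolding open_subopen[of "Y - A"]
  proof
    fix z assume "z \<in> Y - A"
    then show "\<exists>T. open T \<and> z \<in> T \<and> T \<subseteq> Y - A" using near[of z] by blast
  qed
  have discA: "Y \<inter> disc0 \<delta> \<subseteq> A"
  proof -
    have "open (Y \<inter> {z. fst z < \<delta>})"
      by (intro open_Int Y_open open_Collect_less continuous_intros)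
    moreover have "Y \<inter> disc0 \<delta> = Y \<inter> {z. fst z < \<delta>}"
      using Y_subset cover0_notin_Y by (auto simp: disc0_def)
    ultimately show ?thesis using zero unfolding A_def by (auto intro!: exI[of _ "Y \<inter> {z. fst z < \<delta>}"])
  qed
  have "A \<subseteq> log_cover" "Y - A \<subseteq> log_cover" using Y_subset by (auto simp: A_def)
  then have op: "openin log_cover0_top (A \<union> disc0 \<delta>)" "openin log_cover0_top (Y - A)"
    using openA openV assms(3)
    by (auto intro: openin_log_cover0_top_open openin_log_cover0_top_disc openin_Un)
  have "(Y - A) \<inter> Y0 = {}"
  proof (rule ccontr)
    assume "(Y - A) \<inter> Y0 \<noteq> {}"
    moreover have "(A \<union> disc0 \<delta>) \<inter> Y0 \<noteq> {}" by (auto simp: disc0_def)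
    moreover have "Y0 \<subseteq> (A \<union> disc0 \<delta>) \<union> (Y - A)" by (auto simp: disc0_def)
    moreover have "(A \<union> disc0 \<delta>) \<inter> (Y - A) \<inter> Y0 = {}" using discA by blast
    ultimately show False using conn op unfolding connectedin by blast
  qed
  then show ?thesis using z by (auto simp: A_def)
qed

text \<open>Every disc about \<open>cover0\<close> contains positive reals of Y, so no neighbourhood
  of \<open>cover0\<close> avoids the zeros of d.\<close>

lemma continuous_vanishing_at_0:
  fixes d :: "cover_point \<Rightarrow> 'r::real_normed_vector"
  assumes "continuous_map Y0_top euclidean d" "\<And>z. z \<in> Y \<Longrightarrow> d z = 0"
  shows "d cover0 = 0"
proof (rule ccontr)
  assume ne: "d cover0 \<noteq> 0"
  have "openin Y0_top {z \<in> topspace Y0_top. d z \<in> - {0}}"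
    by (rule openin_continuous_map_preimage[OF assms(1)]) auto
  then obtain U where U: "openin log_cover0_top U" "{z \<in> Y0. d z \<noteq> 0} = U \<inter> Y0"
    unfolding topspace_Y0_top openin_subtopology by auto
  then have "cover0 \<in> U" using ne by blast
  then obtain \<rho> where \<rho>: "\<rho> > 0" "disc0 \<rho> \<subseteq> U"
    using openin_log_cover0_top_disc0[OF U(1)] by blast
  obtain x where "(x, 0) \<in> Y \<inter> disc0 \<rho>" using Y_disc0_nonempty[OF \<rho>(1)] by blast
  then have "(x, 0) \<in> {z \<in> Y0. d z \<noteq> 0}" using \<rho>(2) U(2) by blast
  then show False using assms(2)[of "(x, 0)"] \<open>(x, 0) \<in> Y \<inter> disc0 \<rho>\<close> by simp
qed

lemma hahn_holomorphic_cong: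
  assumes "hahn_holomorphic Y e f" "\<And>z. z \<in> Y0 \<Longrightarrow> f z = g z"
  shows "hahn_holomorphic Y e g"
  unfolding hahn_holomorphic_def
proof (intro conjI)
  show "continuous_map Y0_top euclidean g"
    by (rule continuous_map_eq[of _ _ f]) (use assms topspace_Y0_top in \<open>auto simp: hahn_holomorphic_def\<close>)
  show "cover_holomorphic Y g"
    by (rule cover_holomorphic_cong[OF Y_open, of f]) (use assms in \<open>auto simp: hahn_holomorphic_def\<close>)
  show "\<exists>a. is_hahn_series_of Y e a g"
    using assms is_hahn_series_of_cong[of f g] by (auto simp: hahn_holomorphic_def)
qed

lemma hahn_holomorphic_restrict:
  "hahn_holomorphic Y e f \<Longrightarrow> hahn_holomorphic Y e (restrict f Y0)"
  by (rule hahn_holomorphic_cong) auto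

lemma hahn_holomorphic_add:
  "hahn_holomorphic Y e f \<Longrightarrow> hahn_holomorphic Y e g \<Longrightarrow> hahn_holomorphic Y e (\<lambda>z. f z + g z)"
  unfolding hahn_holomorphic_def
  by (elim conjE exE, intro conjI exI) (rule continuous_map_add cover_holomorphic_add is_hahn_series_of_add; assumption)+

lemma hahn_holomorphic_mult:
  "hahn_holomorphic Y e f \<Longrightarrow> hahn_holomorphic Y e g \<Longrightarrow> hahn_holomorphic Y e (\<lambda>z. f z * g z)"
  unfolding hahn_holomorphic_def
  by (elim conjE exE, intro conjI exI) (rule continuous_map_mult_algebra cover_holomorphic_mult is_hahn_series_of_mult; assumption)+

lemma hahn_holomorphic_uminus:
  "hahn_holomorphic Y e f \<Longrightarrow> hahn_holomorphic Y e (\<lambda>z. - f z)"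
  unfolding hahn_holomorphic_def
  by (elim conjE exE, intro conjI exI) (rule continuous_map_minus cover_holomorphic_uminus is_hahn_series_of_uminus; assumption)+

lemma hahn_holomorphic_const: "hahn_holomorphic Y e (\<lambda>_. u)"
  unfolding hahn_holomorphic_def
  by (intro conjI exI) (simp, rule cover_holomorphic_const, rule is_hahn_series_of_const)

lemma is_hahn_series_of_hahn_series_of:
  assumes "hahn_holomorphic Y e h"
  shows "is_hahn_series_of Y e (hahn_series_of Y e h) h"
proof -
  obtain a where "is_hahn_series_of Y e a h" using assms by (auto simp: hahn_holomorphic_def)
  then show ?thesis using hahn_series_of_eq by metis
qed

text \<open>The common series gives equality near 0 by uniqueness of sums, the identity theorem
  extends it to Y, and continuity adds the point \<open>cover0\<close>.\<close>

lemma hahn_series_of_injective: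
  fixes f g :: "cover_point \<Rightarrow> 'r::complex_banach_algebra"
  assumes "connectedin log_cover0_top Y0" "hahn_holomorphic Y e f" "hahn_holomorphic Y e g"
    and eq: "hahn_series_of Y e f = hahn_series_of Y e g" and z: "z \<in> Y0"
  shows "f z = g z"
proof -
  let ?d = "\<lambda>z. f z + - g z"
  have d: "hahn_holomorphic Y e ?d"
    by (intro hahn_holomorphic_add hahn_holomorphic_uminus assms)
  let ?a = "hahn_series_of Y e f"
  have "is_hahn_series_of Y e ?a f" "is_hahn_series_of Y e ?a g"
    using assms(2,3) eq is_hahn_series_of_hahn_series_of by metis+
  then obtain \<delta> where \<delta>: "\<delta> > 0" "converges_to ?a f \<delta>" "converges_to ?a g \<delta>"
    by (rule is_hahn_series_of_common_radius)
  have near: "?d z = 0" if "z \<in> Y \<inter> disc0 \<delta>" for z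
  proof -
    have "f z = g z"
      using \<delta>(2,3) that has_sum_unique[of "\<lambda>\<gamma>. e \<gamma> z *\<^sub>C ?a \<gamma>" "supp ?a" "f z" "g z"]
      unfolding converges_to_def by blast
    then show ?thesis by simp
  qed
  have "cover_holomorphic Y ?d" using d by (simp add: hahn_holomorphic_def)
  then have Y: "?d z = 0" if "z \<in> Y" for z
    using vanishing_near_0[of ?d \<delta> z] assms(1) \<delta>(1) near that by blast
  moreover have "?d cover0 = 0"
    by (rule continuous_vanishing_at_0[OF _ Y]) (use d in \<open>auto simp: hahn_holomorphic_def\<close>)
  ultimately have "?d z = 0" using z by blast
  then show ?thesis by simp
qed

section \<open>The ring of Hahn holomorphic functions\<close>

lemma hahn_holomorphic_ring_simps:
  "h \<in> carrier (hahn_holomorphic_ring Y e) \<longleftrightarrow> h \<in> extensional Y0 \<and> hahn_holomorphic Y e h"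
  "f \<otimes>\<^bsub>hahn_holomorphic_ring Y e\<^esub> g = restrict (\<lambda>z. f z * g z) Y0"
  "f \<oplus>\<^bsub>hahn_holomorphic_ring Y e\<^esub> g = restrict (\<lambda>z. f z + g z) Y0"
  "\<one>\<^bsub>hahn_holomorphic_ring Y e\<^esub> = restrict (\<lambda>z. alg_unit) Y0"
  "\<zero>\<^bsub>hahn_holomorphic_ring Y e\<^esub> = restrict (\<lambda>z. 0) Y0"
  by (simp_all add: hahn_holomorphic_ring_def)

lemma hahn_series_ring_simps:
  "a \<in> carrier hahn_series_ring \<longleftrightarrow> well_ordered (supp a)"
  "a \<otimes>\<^bsub>hahn_series_ring\<^esub> b = hahn_mult a b"
  "a \<oplus>\<^bsub>hahn_series_ring\<^esub> b = (\<lambda>\<gamma>. a \<gamma> + b \<gamma>)"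
  "\<one>\<^bsub>hahn_series_ring\<^esub> = (\<lambda>\<gamma>. if \<gamma> = 0 then alg_unit else 0)"
  by (simp_all add: hahn_series_ring_def)

lemma restrict_eqI:
  "h \<in> extensional A \<Longrightarrow> (\<And>z. z \<in> A \<Longrightarrow> f z = h z) \<Longrightarrow> restrict f A = h"
  by (rule extensionalityI[of _ A]) auto

lemma abelian_group_hahn_holomorphic:
  "abelian_group (hahn_holomorphic_ring Y e :: (cover_point \<Rightarrow> 'r::complex_banach_algebra) ring)"
proof (rule abelian_groupI, goal_cases)
  \<comment> \<open>The existence of additive inverses is the one axiom that needs a
    witness.\<close>
  case (6 x)
  let ?y = "restrict (\<lambda>z. - x z) Y0"
  have "?y \<in> carrier (hahn_holomorphic_ring Y e)"
    using 6 by (auto simp: hahn_holomorphic_ring_simps intro!: hahn_holomorphic_restrict hahn_holomorphic_uminus)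
  moreover have "?y \<oplus>\<^bsub>hahn_holomorphic_ring Y e\<^esub> x = \<zero>\<^bsub>hahn_holomorphic_ring Y e\<^esub>"
    by (auto simp: hahn_holomorphic_ring_simps restrict_def)
  ultimately show ?case by blast
qed (auto simp: hahn_holomorphic_ring_simps add.commute add.assoc intro!: hahn_holomorphic_restrict
    hahn_holomorphic_add hahn_holomorphic_const restrict_eqI)

lemma nonunital_ring_hahn_holomorphic:
  "nonunital_ring (hahn_holomorphic_ring Y e :: (cover_point \<Rightarrow> 'r::complex_banach_algebra) ring)"
proof (intro nonunital_ring.intro nonunital_ring_axioms.intro abelian_group_hahn_holomorphic)
qed (auto simp: hahn_holomorphic_ring_simps mult.assoc distrib_left distrib_right
    intro!: hahn_holomorphic_restrict hahn_holomorphic_mult restrict_eqI)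

lemma hahn_series_of_restrict:
  assumes "is_hahn_series_of Y e a h"
  shows "hahn_series_of Y e (restrict h Y0) = a"
  by (rule hahn_series_of_eq) (use assms is_hahn_series_of_cong[of "restrict h Y0" h] in auto)

lemma hahn_series_of_hom:
  "hahn_series_of Y e \<in> nonunital_ring_hom (hahn_holomorphic_ring Y e)
    (hahn_series_ring :: ('g \<Rightarrow> 'r::complex_banach_algebra) ring)"
proof -
  have "well_ordered (supp (hahn_series_of Y e h))" if "hahn_holomorphic Y e h" for h :: "cover_point \<Rightarrow> 'r"
    using is_hahn_series_of_hahn_series_of[OF that]
    by (auto simp: is_hahn_series_of_def admissible_iff)
  then show ?thesis
    unfolding nonunital_ring_hom_def
    by (auto simp: hom_def hahn_holomorphic_ring_simps hahn_series_ring_simps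
        intro!: hahn_series_of_restrict is_hahn_series_of_mult is_hahn_series_of_add
          is_hahn_series_of_hahn_series_of)
qed

lemma hahn_series_of_bij_betw_image:
  assumes "connectedin log_cover0_top Y0"
  shows "bij_betw (hahn_series_of Y e :: (cover_point \<Rightarrow> 'r::complex_banach_algebra) \<Rightarrow> _)
    (carrier (hahn_holomorphic_ring Y e)) (hahn_series_of Y e ` carrier (hahn_holomorphic_ring Y e))"
proof (rule inj_on_imp_bij_betw, rule inj_onI)
  fix f g :: "cover_point \<Rightarrow> 'r"
  assume fg: "f \<in> carrier (hahn_holomorphic_ring Y e)" "g \<in> carrier (hahn_holomorphic_ring Y e)"
    and eq: "hahn_series_of Y e f = hahn_series_of Y e g"
  show "f = g"
    by (rule extensionalityI[of _ Y0])
      (use fg hahn_series_of_injective[OF assms _ _ eq] in \<open>auto simp: hahn_holomorphic_ring_simps\<close>)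
qed

end

text \<open>Two units agree, as u = u * v = v, so the description in \<open>alg_unit\<close> has a
  unique solution.\<close>

lemma is_alg_unit_alg_unit:
  assumes "is_alg_unit (u :: 'r::complex_banach_algebra)"
  shows "is_alg_unit (alg_unit :: 'r)"
  unfolding alg_unit_def
proof (rule theI[of _ u])
  fix v :: 'r assume "is_alg_unit v"
  then show "v = u" using assms unfolding is_alg_unit_def by metis
qed fact

text \<open>The algebra may lack a unit, so the unital notions appear under the hypothesis that one
  exists. The isomorphism is asserted for connected \<open>Y0\<close>, because a series knows only
  the germ at 0: if \<open>Y0\<close> splits, a function that is a nonzero constant on the part away
  from 0 and vanishes elsewhere has the zero series.\<close>

theorem proposition2p9:
  fixes Y :: "cover_point set"
    and e :: "'g::linordered_ab_group_add \<Rightarrow> cover_point \<Rightarrow> complex"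
  assumes "exponent_system Y e"
  shows
    "let H = (hahn_holomorphic_ring Y e :: (cover_point \<Rightarrow> 'r::complex_banach_algebra) ring);
         K = (hahn_series_ring :: ('g \<Rightarrow> 'r) ring);
         \<psi> = (hahn_series_of Y e :: (cover_point \<Rightarrow> 'r) \<Rightarrow> 'g \<Rightarrow> 'r);
         im = K\<lparr>carrier := \<psi> ` carrier H\<rparr>;
         Y0_connected = connectedin log_cover0_top (insert cover0 Y)
     in nonunital_ring H
        \<and> \<psi> \<in> nonunital_ring_hom H K
        \<and> (Y0_connected \<longrightarrow> \<psi> \<in> nonunital_ring_iso H im)
        \<and> ((\<exists>u::'r. is_alg_unit u) \<longrightarrow>
             ring H \<and> \<psi> \<in> ring_hom H K \<and> (Y0_connected \<longrightarrow> \<psi> \<in> ring_iso H im))"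
proof -
  interpret exponent_system Y e by fact
  define H where "H = (hahn_holomorphic_ring Y e :: (cover_point \<Rightarrow> 'r) ring)"
  define K where "K = (hahn_series_ring :: ('g \<Rightarrow> 'r) ring)"
  define \<psi> where "\<psi> = (hahn_series_of Y e :: (cover_point \<Rightarrow> 'r) \<Rightarrow> 'g \<Rightarrow> 'r)"
  define im where "im = K\<lparr>carrier := \<psi> ` carrier H\<rparr>"
  have H: "nonunital_ring H"
    unfolding H_def by (rule nonunital_ring_hahn_holomorphic)
  interpret H: nonunital_ring H by (rule H)
  have hom: "\<psi> \<in> nonunital_ring_hom H K"
    unfolding H_def K_def \<psi>_def by (rule hahn_series_of_hom)
  then have hom_im: "\<psi> \<in> nonunital_ring_hom H im"
    \<comment> \<open>The image \<open>im\<close> keeps the operations and the unit of K; only the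
      carrier shrinks.\<close>
    by (auto simp: nonunital_ring_hom_def hom_def im_def)
  have bij: "bij_betw \<psi> (carrier H) (carrier im)" if "connectedin log_cover0_top Y0"
    using hahn_series_of_bij_betw_image[OF that] by (simp add: H_def \<psi>_def im_def)
  have unital: "ring H \<and> \<psi> \<in> ring_hom H K \<and> \<psi> \<in> ring_hom H im" if "is_alg_unit u" for u :: 'r
  proof -
    have unit: "alg_unit * x = x" "x * alg_unit = x" for x :: 'r
      using is_alg_unit_alg_unit[OF that] by (auto simp: is_alg_unit_def)
    have "monoid H"
    proof
      show "\<one>\<^bsub>H\<^esub> \<in> carrier H"
        unfolding H_def hahn_holomorphic_ring_simps by (auto intro: hahn_holomorphic_restrict hahn_holomorphic_const)
      show "\<one>\<^bsub>H\<^esub> \<otimes>\<^bsub>H\<^esub> x = x" "x \<otimes>\<^bsub>H\<^esub> \<one>\<^bsub>H\<^esub> = x" if "x \<in> carrier H" for x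
        using that unfolding H_def hahn_holomorphic_ring_simps by (auto intro: restrict_eqI simp: unit)
    qed (auto intro: H.nu_m_closed H.nu_m_assoc)
    then have "ring H"
      by (intro ring.intro ring_axioms.intro H.abelian_group_axioms H.nu_l_distr H.nu_r_distr)
    moreover have "\<psi> \<one>\<^bsub>H\<^esub> = \<one>\<^bsub>K\<^esub>"
      unfolding H_def K_def \<psi>_def hahn_holomorphic_ring_simps hahn_series_ring_simps
      by (rule hahn_series_of_restrict[OF is_hahn_series_of_const])
    ultimately show ?thesis
      using hom hom_im by (auto simp: nonunital_ring_hom_def hom_def ring_hom_def im_def)
  qed
  show ?thesis
    unfolding Let_def H_def[symmetric] K_def[symmetric] \<psi>_def[symmetric] im_def[symmetric]
    using H hom hom_im bij unital by (auto simp: nonunital_ring_iso_def ring_iso_def)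
qed

end
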